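(* Let $m\ge 2$, $N\ge 1$, and let $O_1,\dots,O_N$ be obstacles on the torus $\mathbb{T}^m=\mathbb{R}^m/\mathbb{Z}^m$ satisfying the standing assumptions listed in the context. Then the admissible rotation set $AR\subset\mathbb{R}^m$ of the billiard in the exterior of these obstacles is convex.
   Context: Setting. $m\ge 2$, $\mathbb{T}^m=\mathbb{R}^m/\mathbb{Z}^m$, $\phi:\mathbb{R}^m\to\mathbb{T}^m$ is the natural covering, $S_0=[0,1]^m$. The obstacles $O_1,\dots,O_N\subset\mathbb{T}^m$ are pairwise disjoint strictly convex bodies (compact, with nonempty interior) with $C^2$ boundary and diameter less than $\frac{\sqrt2}{4}$. Coordinates are chosen so that $O_{(\mathbf 0,r)}:=\phi^{-1}(O_r)\cap[0,1]^m$ is a copy of $O_r$ contained in the interior of $[0,1]^m$ for each $r$. For $\mathbf k\in\mathbb{Z}^m$ put $O_{(\mathbf k,r)}=O_{(\mathbf 0,r)}+\mathbf k$; these sets are called obstacles in $\mathbb{R}^m$. Standing assumptions: (a) for every coordinate projection $\pi_i(x_1,\dots,x_m)=x_i$ and all $r\ne r'$, $\pi_i(O_{(\mathbf 0,r)})\cap\pi_i(O_{(\mathbf 0,r')})=\emptyset$; (b) no-eclipse in $S_0$: for pairwise distinct $r,s,t$, the convex hull of $O_{(\mathbf 0,r)}\cup O_{(\mathbf 0,s)}$ is disjoint from $O_{(\mathbf 0,t)}$. Billiard. Trajectories are considered in $\Omega=\overline{\mathbb{R}^m\setminus\bigcup_{\mathbf k,r}O_{(\mathbf k,r)}}$: straight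 motion with unit speed inside $\Omega$ and reflection at the boundary with angle of incidence equal to angle of reflection. A trajectory (piece) is of type $(\mathbf k_n,r_n)_{n=0}^p$ ($p\le\infty$) if it starts at a point of $\partial O_{(\mathbf k_0,r_0)}$ and its consecutive reflections are from $O_{(\mathbf k_n,r_n)}$, $n=1,2,\dots$; for $p<\infty$ the piece ends at a point of $\partial O_{(\mathbf k_p,r_p)}$. Between. An obstacle $O_{(\mathbf k,r)}$, different from $O_{(\mathbf i,s)}$ and $O_{(\mathbf j,t)}$, is between $O_{(\mathbf i,s)}$ and $O_{(\mathbf j,t)}$ if it has a common point with the convex hull of $O_{(\mathbf i,s)}\cup O_{(\mathbf j,t)}$. Admissible sequence. A sequence $(\mathbf k_n,r_n)_{n=0}^p$ in $\mathbb{Z}^m\times\{1,\dots,N\}$ ($p$ finite or $\infty$) is admissible if (i) $\mathbf k_0=\mathbf 0$; (ii) $(\mathbf k_{n+1},r_{n+1})\neq(\mathbf k_n,r_n)$ for every $n<p$; (iii) for every $n<p$ there is no obstacle between $O_{(\mathbf k_n,r_n)}$ and $O_{(\mathbf k_{n+1},r_{n+1})}$; (iv) for every $n<p-1$ the obstacle $O_{(\mathbf k_{n+1},r_{n+1})}$ is not between $O_{(\mathbf k_n,r_n)}$ and $O_{(\mathbf k_{n+2},r_{n+2})}$. Admissible rotation set. For a trajectory piece $T$ from $\mathbf x$ to $\mathbf y$ in $\mathbb{R}^m$ let $|T|$ be its length and $d(T)=\mathbf y-\mathbf x$ its displacement. $AR$ is the set of all limit points of sequences $\left(\frac{d(T_n)}{|T_n|}\right)_{n\ge1}$,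 where each $T_n$ is a trajectory piece whose type is a (finite) admissible sequence and $|T_n|\to\infty$. *)

theory Defs
  imports "HOL-Analysis.Analysis"
begin

definition int_vec :: "int ^ 'm \<Rightarrow> real ^ 'm" where
  "int_vec k = (\<chi> i. of_int (k $ i))"

definition lattice_equiv :: "real ^ 'm \<Rightarrow> real ^ 'm \<Rightarrow> bool" where
  "lattice_equiv x y \<longleftrightarrow> (\<exists>k. x - y = int_vec k)"

quotient_type 'm torus = "real ^ ('m::finite)" / lattice_equiv
  morphisms torus_rep torus_proj
proof (rule equivpI)
  show "reflp (lattice_equiv :: real ^ 'm \<Rightarrow> _)"
    unfolding reflp_def lattice_equiv_def
    by (auto intro!: exI[of _ 0] simp: int_vec_def vec_eq_iff)
  show "symp (lattice_equiv :: real ^ 'm \<Rightarrow> _)"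
  proof (rule sympI)
    fix x y :: "real ^ 'm"
    assume "lattice_equiv x y"
    then obtain k where "x - y = int_vec k"
      unfolding lattice_equiv_def by blast
    then have "y - x = int_vec (- k)"
      by (simp add: int_vec_def vec_eq_iff algebra_simps)
    then show "lattice_equiv y x"
      unfolding lattice_equiv_def by blast
  qed
  show "transp (lattice_equiv :: real ^ 'm \<Rightarrow> _)"
  proof (rule transpI)
    fix x y z :: "real ^ 'm"
    assume "lattice_equiv x y" "lattice_equiv y z"
    then obtain k l where "x - y = int_vec k" "y - z = int_vec l"
      unfolding lattice_equiv_def by blast
    then have "x - z = int_vec (k + l)"
      by (simp add: int_vec_def vec_eq_iff algebra_simps)
    then show "lattice_equiv x z"
      unfolding lattice_equiv_def by blast
  qed
qed

text \<open>
  The obstacles on the torus are a family \<open>Ob\<close> indexed by a finite type \<open>'n\<close>, whose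
  cardinality is the number \<open>N \<ge> 1\<close> of obstacles.
\<close>

definition base_obstacle :: "('n \<Rightarrow> ('m::finite) torus set) \<Rightarrow> 'n \<Rightarrow> (real ^ 'm) set" where
  "base_obstacle Ob r = torus_proj -` Ob r \<inter> cbox 0 1"

definition obstacle :: "('n \<Rightarrow> ('m::finite) torus set) \<Rightarrow> (int ^ 'm) \<times> 'n \<Rightarrow> (real ^ 'm) set" where
  "obstacle Ob q = (\<lambda>x. x + int_vec (fst q)) ` base_obstacle Ob (snd q)"

definition strictly_convex_body :: "'a::euclidean_space set \<Rightarrow> bool" where
  "strictly_convex_body K \<longleftrightarrow>
     compact K \<and> interior K \<noteq> {} \<and>
     (\<forall>x\<in>K. \<forall>y\<in>K. x \<noteq> y \<longrightarrow> open_segment x y \<subseteq> interior K)"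

text \<open>
  The boundary is locally a regular level set of a \<open>C\<^sup>2\<close> function \<open>f\<close>, with gradient \<open>g\<close>
  and Hessian matrix \<open>H\<close>.
\<close>

definition C2_boundary :: "(real ^ 'm) set \<Rightarrow> bool" where
  "C2_boundary K \<longleftrightarrow>
     (\<forall>x \<in> frontier K.
        \<exists>U (f :: real ^ 'm \<Rightarrow> real) (g :: real ^ 'm \<Rightarrow> real ^ 'm) (H :: real ^ 'm \<Rightarrow> real ^ 'm ^ 'm).
          open U \<and> x \<in> U \<and>
          (\<forall>y\<in>U. (f has_derivative (\<lambda>h. g y \<bullet> h)) (at y)) \<and>
          (\<forall>y\<in>U. (g has_derivative (\<lambda>h. H y *v h)) (at y)) \<and>
          continuous_on U H \<and>
          g x \<noteq> 0 \<and>
          frontier K \<inter> U = {y \<in> U. f y = 0})"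

text \<open>
  An obstacle on the torus lifts to a copy in the open unit cube, and its convexity,
  smoothness and diameter are those of that copy. (As the diameter of the copy is below
  one half, it agrees with the diameter for the quotient metric.)
\<close>

definition standing_assumptions :: "('n::finite \<Rightarrow> ('m::finite) torus set) \<Rightarrow> bool" where
  "standing_assumptions Ob \<longleftrightarrow>
     disjoint_family Ob \<and>
     (\<forall>r. base_obstacle Ob r \<subseteq> interior (cbox 0 1) \<and>
          strictly_convex_body (base_obstacle Ob r) \<and>
          C2_boundary (base_obstacle Ob r) \<and>
          diameter (base_obstacle Ob r) < sqrt 2 / 4) \<and>
     (\<forall>i r r'. r \<noteq> r' \<longrightarrow>
          (\<lambda>x. x $ i) ` base_obstacle Ob r \<inter> (\<lambda>x. x $ i) ` base_obstacle Ob r' = {}) \<and>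
     (\<forall>r s t. r \<noteq> s \<and> s \<noteq> t \<and> r \<noteq> t \<longrightarrow>
          convex hull (base_obstacle Ob r \<union> base_obstacle Ob s) \<inter> base_obstacle Ob t = {})"

definition billiard_table :: "('n \<Rightarrow> ('m::finite) torus set) \<Rightarrow> (real ^ 'm) set" where
  "billiard_table Ob = closure (- (\<Union>q. obstacle Ob q))"

text \<open>
  Outer normals of a convex body, by means of supporting hyperplanes; when the boundary is
  differentiable, there is exactly one outer unit normal at each boundary point.
\<close>

definition outer_unit_normal :: "(real ^ 'm) set \<Rightarrow> real ^ 'm \<Rightarrow> real ^ 'm \<Rightarrow> bool" where
  "outer_unit_normal K x u \<longleftrightarrow> x \<in> frontier K \<and> norm u = 1 \<and> (\<forall>y\<in>K. (y - x) \<bullet> u \<le> 0)"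

text \<open>Angle of incidence equals angle of reflection, for incoming velocity \<open>v\<close>, outgoing \<open>w\<close>.\<close>

definition reflects :: "(real ^ 'm) set \<Rightarrow> real ^ 'm \<Rightarrow> real ^ 'm \<Rightarrow> real ^ 'm \<Rightarrow> bool" where
  "reflects K x v w \<longleftrightarrow> (\<exists>u. outer_unit_normal K x u \<and> w = v - (2 * (v \<bullet> u)) *\<^sub>R u)"

text \<open>
  \<open>trajectory_piece Ob \<gamma> L p \<sigma>\<close>: the curve \<open>\<gamma>\<close> on \<open>{0..L}\<close> is a trajectory piece of type
  \<open>\<sigma> 0, \<dots>, \<sigma> p\<close>. The \<open>\<tau> n\<close> are the start time, the reflection times and the end time, and
  \<open>v n\<close> is the velocity between \<open>\<tau> n\<close> and \<open>\<tau> (Suc n)\<close>. Since the speed is one, the length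
  of the piece is \<open>L\<close>. A grazing contact (where \<open>reflects\<close> leaves the velocity unchanged) may
  be listed as a reflection or not; if \<open>\<sigma>\<close> is admissible, no grazing occurs strictly between
  the end points, so this convention is immaterial below.
\<close>

definition trajectory_piece ::
  "('n \<Rightarrow> ('m::finite) torus set) \<Rightarrow> (real \<Rightarrow> real ^ 'm) \<Rightarrow> real \<Rightarrow> nat \<Rightarrow>
     (nat \<Rightarrow> (int ^ 'm) \<times> 'n) \<Rightarrow> bool" where
  "trajectory_piece Ob \<gamma> L p \<sigma> \<longleftrightarrow>
     (\<exists>(\<tau> :: nat \<Rightarrow> real) (v :: nat \<Rightarrow> real ^ 'm).
        \<tau> 0 = 0 \<and> \<tau> p = L \<and>
        (\<forall>n<p. \<tau> n < \<tau> (Suc n) \<and> norm (v n) = 1 \<and>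
           (\<forall>t \<in> {\<tau> n..\<tau> (Suc n)}.
              \<gamma> t = \<gamma> (\<tau> n) + (t - \<tau> n) *\<^sub>R v n \<and> \<gamma> t \<in> billiard_table Ob)) \<and>
        (\<forall>n\<le>p. \<gamma> (\<tau> n) \<in> frontier (obstacle Ob (\<sigma> n))) \<and>
        (\<forall>n. Suc n < p \<longrightarrow>
           reflects (obstacle Ob (\<sigma> (Suc n))) (\<gamma> (\<tau> (Suc n))) (v n) (v (Suc n))))"

definition obstacle_between ::
  "('n \<Rightarrow> ('m::finite) torus set) \<Rightarrow> (int ^ 'm) \<times> 'n \<Rightarrow> (int ^ 'm) \<times> 'n \<Rightarrow> (int ^ 'm) \<times> 'n \<Rightarrow> bool"
  where
  "obstacle_between Ob q a b \<longleftrightarrow>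
     q \<noteq> a \<and> q \<noteq> b \<and> obstacle Ob q \<inter> convex hull (obstacle Ob a \<union> obstacle Ob b) \<noteq> {}"

text \<open>Only the values \<open>\<sigma> 0, \<dots>, \<sigma> p\<close> matter.\<close>

definition admissible ::
  "('n \<Rightarrow> ('m::finite) torus set) \<Rightarrow> nat \<Rightarrow> (nat \<Rightarrow> (int ^ 'm) \<times> 'n) \<Rightarrow> bool" where
  "admissible Ob p \<sigma> \<longleftrightarrow>
     fst (\<sigma> 0) = 0 \<and>
     (\<forall>n<p. \<sigma> (Suc n) \<noteq> \<sigma> n) \<and>
     (\<forall>n<p. \<nexists>q. obstacle_between Ob q (\<sigma> n) (\<sigma> (Suc n))) \<and>
     (\<forall>n. Suc n < p \<longrightarrow> \<not> obstacle_between Ob (\<sigma> (Suc n)) (\<sigma> n) (\<sigma> (Suc (Suc n))))"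

text \<open>A limit point of a sequence is the limit of some subsequence.\<close>

definition admissible_rotation_set :: "('n \<Rightarrow> ('m::finite) torus set) \<Rightarrow> (real ^ 'm) set" where
  "admissible_rotation_set Ob =
     {w. \<exists>(\<gamma> :: nat \<Rightarrow> real \<Rightarrow> real ^ 'm) L p \<sigma>.
           (\<forall>n. admissible Ob (p n) (\<sigma> n) \<and> trajectory_piece Ob (\<gamma> n) (L n) (p n) (\<sigma> n)) \<and>
           filterlim L at_top sequentially \<and>
           (\<exists>s. strict_mono s \<and>
              ((\<lambda>n. (\<gamma> n (L n) - \<gamma> n 0) /\<^sub>R L n) \<circ> s) \<longlonglongrightarrow> w)}"

end

(* Minimising the length of a broken line through the obstacles of an admissible sequence
   yields a trajectory of that type, and by convexity every trajectory of the type is within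
   an additive constant of the minimal length. Hence length and displacement of a trajectory
   are determined by its type up to bounded errors.

   Two admissible sequences can be joined, after a lattice translation, by boundedly many
   obstacles, moving only between an obstacle and its translates by unit vectors or between
   obstacles of the same cell. By assumption (a), b is not between a and c if a and c lie on
   the same side of b in some coordinate; this allows leaving and entering any sequence and
   changing the obstacle within a cell. The diameter bound allows all turns of unit steps.

   So (length, displacement) is additive along concatenations up to a constant, and convexity
   follows by concatenating many copies of two trajectories in a suitable proportion. *)

theory Submission
  imports Defs
begin

section \<open>Almost additive sets of pairs\<close>

text \<open>Joining types does not join trajectories: the trajectory of the joined type meets every
  obstacle at new points. The comparison therefore goes through \<open>min_length\<close>, which
  sees only the obstacles. Cutting a chain of points makes it superadditive; inserting boundedly
  many links makes it subadditive up to a constant.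

  The combinatorial difficulty is the condition on three consecutive obstacles. An obstacle is
  always between its two opposite neighbours, so runs of equal unit steps are forbidden, and which
  step may follow depends on the last edge, not only on the last obstacle. What a connection has to
  control is the type of its last obstacle and its last unit step. The cell it reaches is left free,
  because the second sequence can be translated there. Leaving, changing the type and adjusting the
  direction append at most 1 + 4 + 2 obstacles; the last of them is the first obstacle of the
  translated sequence, so at most 6 are new and there are at most 7 connecting links.\<close>

definition asymptotic_ratios :: "(real \<times> 'a::real_normed_vector) set \<Rightarrow> 'a set" where
  "asymptotic_ratios E =
     {w. \<exists>e. (\<forall>n. e n \<in> E) \<and> filterlim (\<lambda>n. fst (e n)) at_top sequentially \<and>
             (\<lambda>n. snd (e n) /\<^sub>R fst (e n)) \<longlonglongrightarrow> w}"

text \<open>Joining \<open>Suc n\<close> copies takes \<open>n\<close> joints, and each joint costs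
  at most \<open>K\<close>.\<close>

lemma almost_multiple:
  fixes E :: "(real \<times> 'a::real_normed_vector) set"
  assumes add: "\<And>x y. x \<in> E \<Longrightarrow> y \<in> E \<Longrightarrow>
      \<exists>z\<in>E. \<bar>fst z - fst x - fst y\<bar> \<le> K \<and> norm (snd z - snd x - snd y) \<le> K"
    and x: "x \<in> E"
  shows "\<exists>z\<in>E. \<bar>fst z - real (Suc n) * fst x\<bar> \<le> n * K \<and>
                norm (snd z - real (Suc n) *\<^sub>R snd x) \<le> n * K"
proof (induction n)
  case 0
  then show ?case using x by (intro bexI[of _ x]) auto
next
  case (Suc n)
  then obtain z where z: "z \<in> E" "\<bar>fst z - real (Suc n) * fst x\<bar> \<le> n * K"
    "norm (snd z - real (Suc n) *\<^sub>R snd x) \<le> n * K" by blast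
  obtain y where y: "y \<in> E" "\<bar>fst y - fst z - fst x\<bar> \<le> K" "norm (snd y - snd z - snd x) \<le> K"
    using add[OF z(1) x] by blast
  have "\<bar>fst y - real (Suc (Suc n)) * fst x\<bar> \<le> Suc n * K"
    using y(2) z(2) by (simp add: algebra_simps abs_le_iff)
  moreover have "norm (snd y - real (Suc (Suc n)) *\<^sub>R snd x) \<le> Suc n * K"
  proof -
    have "snd y - real (Suc (Suc n)) *\<^sub>R snd x
        = (snd y - snd z - snd x) + (snd z - real (Suc n) *\<^sub>R snd x)"
      by (simp add: algebra_simps scaleR_2)
    also have "norm \<dots> \<le> K + n * K"
      using y(3) z(3) by (intro norm_triangle_le add_mono)
    finally show ?thesis by (simp add: algebra_simps)
  qed
  ultimately show ?case using y(1) by blast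
qed

lemma almost_combination:
  fixes E :: "(real \<times> 'a::real_normed_vector) set"
  assumes add: "\<And>x y. x \<in> E \<Longrightarrow> y \<in> E \<Longrightarrow>
      \<exists>z\<in>E. \<bar>fst z - fst x - fst y\<bar> \<le> K \<and> norm (snd z - snd x - snd y) \<le> K"
    and x: "x \<in> E" and y: "y \<in> E" and a: "0 < (a::nat)" and b: "0 < (b::nat)"
  shows "\<exists>z\<in>E. \<bar>fst z - a * fst x - b * fst y\<bar> \<le> (real a + real b) * K \<and>
                norm (snd z - a *\<^sub>R snd x - b *\<^sub>R snd y) \<le> (real a + real b) * K"
proof -
  obtain u where u: "u \<in> E" "\<bar>fst u - real a * fst x\<bar> \<le> real (a - 1) * K"
    "norm (snd u - a *\<^sub>R snd x) \<le> real (a - 1) * K"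
    using almost_multiple[OF add x, of "a - 1"] a by auto
  obtain v where v: "v \<in> E" "\<bar>fst v - real b * fst y\<bar> \<le> real (b - 1) * K"
    "norm (snd v - b *\<^sub>R snd y) \<le> real (b - 1) * K"
    using almost_multiple[OF add y, of "b - 1"] b by auto
  obtain z where z: "z \<in> E" "\<bar>fst z - fst u - fst v\<bar> \<le> K" "norm (snd z - snd u - snd v) \<le> K"
    using add[OF u(1) v(1)] by blast
  have K: "K \<ge> 0" using z(2) by linarith
  have le: "real (a - 1) * K + real (b - 1) * K + K \<le> (real a + real b) * K"
    using a b K by (simp add: algebra_simps of_nat_diff)
  have "\<bar>fst z - a * fst x - b * fst y\<bar> \<le> (real a + real b) * K"
    using u(2) v(2) z(2) le by linarith
  moreover have "norm (snd z - a *\<^sub>R snd x - b *\<^sub>R snd y) \<le> (real a + real b) * K"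
  proof -
    have "snd z - a *\<^sub>R snd x - b *\<^sub>R snd y
        = (snd u - a *\<^sub>R snd x) + (snd v - b *\<^sub>R snd y) + (snd z - snd u - snd v)"
      by simp
    also have "norm \<dots> \<le> real (a - 1) * K + real (b - 1) * K + K"
      using u(3) v(3) z(3) by (intro norm_triangle_le add_mono) auto
    finally show ?thesis using le by linarith
  qed
  ultimately show ?thesis using z(1) by blast
qed

text \<open>Numbers of copies are chosen so that the two kinds occupy fractions \<open>1 - t\<close>
  and \<open>t\<close> of the total length. The ratios then converge to the convex combination,
  since the lengths of the single copies tend to infinity and the cost per joint stays
  bounded.\<close>

lemma convex_asymptotic_ratios:
  fixes E :: "(real \<times> 'a::real_normed_vector) set"
  assumes add: "\<And>x y. x \<in> E \<Longrightarrow> y \<in> E \<Longrightarrow>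
      \<exists>z\<in>E. \<bar>fst z - fst x - fst y\<bar> \<le> K \<and> norm (snd z - snd x - snd y) \<le> K"
    and pos: "\<And>x. x \<in> E \<Longrightarrow> fst x > 0"
  shows "convex (asymptotic_ratios E)"
  unfolding convex_alt
proof (intro ballI allI impI)
  fix w w' :: 'a and t :: real
  assume w: "w \<in> asymptotic_ratios E" and w': "w' \<in> asymptotic_ratios E" and t: "0 \<le> t \<and> t \<le> 1"
  obtain e where e: "\<And>n. e n \<in> E" "filterlim (\<lambda>n. fst (e n)) at_top sequentially"
      "(\<lambda>n. snd (e n) /\<^sub>R fst (e n)) \<longlonglongrightarrow> w"
    using w unfolding asymptotic_ratios_def by blast
  obtain f where f: "\<And>n. f n \<in> E" "filterlim (\<lambda>n. fst (f n)) at_top sequentially"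
      "(\<lambda>n. snd (f n) /\<^sub>R fst (f n)) \<longlonglongrightarrow> w'"
    using w' unfolding asymptotic_ratios_def by blast
  define l where "l n = fst (e n)" for n
  define l' where "l' n = fst (f n)" for n
  have lpos: "l n > 0" "l' n > 0" for n
    using pos e(1) f(1) by (auto simp: l_def l'_def)
  define S where "S n = real (Suc n) * l n * l' n" for n
  have Spos: "S n > 0" for n using lpos by (simp add: S_def)
  \<comment> \<open>The product \<open>a n * l n\<close> should be close to
    \<open>(1 - t) * S n\<close>, and \<open>b n * l' n\<close> to \<open>t * S n\<close>. The
    \<open>+ 1\<close> keeps both multiplicities positive, as \<open>almost_combination\<close>
    demands, even when \<open>t\<close> is 0 or 1.\<close>
  define a where "a n = nat \<lfloor>(1 - t) * Suc n * l' n\<rfloor> + 1" for n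
  define b where "b n = nat \<lfloor>t * Suc n * l n\<rfloor> + 1" for n
  have ab: "0 < a n" "0 < b n" for n by (auto simp: a_def b_def)
  have inv_l: "(\<lambda>n. 1 / l n) \<longlonglongrightarrow> 0" "(\<lambda>n. 1 / l' n) \<longlonglongrightarrow> 0"
    unfolding l_def l'_def divide_inverse
    by (auto intro!: tendsto_inverse_0_at_top e(2) f(2))
  have floor_bound: "\<bar>real (nat \<lfloor>r\<rfloor> + 1) - r\<bar> \<le> 1" if "r \<ge> 0" for r :: real
    using that by (simp add: of_nat_nat) linarith
  have p: "(\<lambda>n. a n * l n / S n) \<longlonglongrightarrow> 1 - t"
  proof (rule LIM_zero_cancel, rule tendsto_rabs_zero_cancel, rule tendsto_sandwich[OF _ _ tendsto_const])
    show "\<forall>\<^sub>F n in sequentially. \<bar>a n * l n / S n - (1 - t)\<bar> \<le> 1 / l' n"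
    proof (intro always_eventually allI)
      fix n
      have "a n * l n / S n - (1 - t) = (a n - (1 - t) * Suc n * l' n) / (Suc n * l' n)"
        using lpos[of n] unfolding S_def by (simp add: field_simps del: of_nat_Suc)
      also have "\<bar>\<dots>\<bar> \<le> 1 / (Suc n * l' n)"
        unfolding abs_divide
        using floor_bound[of "(1 - t) * Suc n * l' n"] lpos[of n] t
        by (intro frac_le) (auto simp: a_def abs_mult simp del: of_nat_Suc)
      also have "\<dots> \<le> 1 / l' n"
        using lpos[of n] by (intro frac_le) (auto simp: algebra_simps)
      finally show "\<bar>a n * l n / S n - (1 - t)\<bar> \<le> 1 / l' n" .
    qed
  qed (use inv_l in auto)
  have q: "(\<lambda>n. b n * l' n / S n) \<longlonglongrightarrow> t"
  proof (rule LIM_zero_cancel, rule tendsto_rabs_zero_cancel, rule tendsto_sandwich[OF _ _ tendsto_const])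
    show "\<forall>\<^sub>F n in sequentially. \<bar>b n * l' n / S n - t\<bar> \<le> 1 / l n"
    proof (intro always_eventually allI)
      fix n
      have "b n * l' n / S n - t = (b n - t * Suc n * l n) / (Suc n * l n)"
        using lpos[of n] unfolding S_def by (simp add: field_simps del: of_nat_Suc)
      also have "\<bar>\<dots>\<bar> \<le> 1 / (Suc n * l n)"
        unfolding abs_divide
        using floor_bound[of "t * Suc n * l n"] lpos[of n] t
        by (intro frac_le) (auto simp: b_def abs_mult simp del: of_nat_Suc)
      also have "\<dots> \<le> 1 / l n"
        using lpos[of n] by (intro frac_le) (auto simp: algebra_simps)
      finally show "\<bar>b n * l' n / S n - t\<bar> \<le> 1 / l n" .
    qed
  qed (use inv_l in auto)
  have "\<forall>n. \<exists>z\<in>E. \<bar>fst z - a n * l n - b n * l' n\<bar> \<le> (real (a n) + real (b n)) * K \<and>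
      norm (snd z - a n *\<^sub>R snd (e n) - b n *\<^sub>R snd (f n)) \<le> (real (a n) + real (b n)) * K"
    unfolding l_def l'_def by (intro allI almost_combination add e(1) f(1) ab)
  then obtain z where z: "\<And>n. z n \<in> E"
      "\<And>n. \<bar>fst (z n) - a n * l n - b n * l' n\<bar> \<le> (real (a n) + real (b n)) * K"
      "\<And>n. norm (snd (z n) - a n *\<^sub>R snd (e n) - b n *\<^sub>R snd (f n)) \<le> (real (a n) + real (b n)) * K"
    by metis
  \<comment> \<open>The number of copies is negligible against \<open>S n\<close>:
    \<open>a n / S n\<close> is the convergent fraction \<open>a n * l n / S n\<close> divided by
    \<open>l n\<close>, which tends to infinity; likewise for \<open>b n\<close>.\<close>
  define err where "err n = (real (a n) + real (b n)) * K / S n" for n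
  have err: "err \<longlonglongrightarrow> 0"
  proof -
    have "(\<lambda>n. (a n * l n / S n) * (1 / l n) * K + (b n * l' n / S n) * (1 / l' n) * K)
        \<longlonglongrightarrow> (1 - t) * 0 * K + t * 0 * K"
      by (intro tendsto_intros p q inv_l)
    moreover have "(a n * l n / S n) * (1 / l n) * K + (b n * l' n / S n) * (1 / l' n) * K = err n" for n
      using lpos[of n] Spos[of n] by (simp add: err_def field_simps)
    ultimately show ?thesis by (simp add: fun_eq_iff[symmetric])
  qed
  have zf: "(\<lambda>n. fst (z n) / S n) \<longlonglongrightarrow> 1"
  proof -
    have "(\<lambda>n. fst (z n) / S n - (a n * l n / S n + b n * l' n / S n)) \<longlonglongrightarrow> 0"
    proof (rule tendsto_rabs_zero_cancel, rule tendsto_sandwich[OF _ _ tendsto_const err])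
      show "\<forall>\<^sub>F n in sequentially. \<bar>fst (z n) / S n - (a n * l n / S n + b n * l' n / S n)\<bar> \<le> err n"
      proof (intro always_eventually allI)
        fix n
        have "fst (z n) / S n - (a n * l n / S n + b n * l' n / S n)
            = (fst (z n) - a n * l n - b n * l' n) / S n"
          by (simp add: diff_divide_distrib)
        then show "\<bar>fst (z n) / S n - (a n * l n / S n + b n * l' n / S n)\<bar> \<le> err n"
          unfolding err_def using z(2)[of n] Spos[of n] by (simp add: divide_right_mono)
      qed
    qed simp
    from tendsto_add[OF this tendsto_add[OF p q]] show ?thesis by simp
  qed
  have zs: "(\<lambda>n. snd (z n) /\<^sub>R S n) \<longlonglongrightarrow> (1 - t) *\<^sub>R w + t *\<^sub>R w'"
  proof -
    define c where "c n = (a n * l n / S n) *\<^sub>R (snd (e n) /\<^sub>R l n)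
        + (b n * l' n / S n) *\<^sub>R (snd (f n) /\<^sub>R l' n)" for n
    have c: "c \<longlonglongrightarrow> (1 - t) *\<^sub>R w + t *\<^sub>R w'"
      unfolding c_def using e(3) f(3) p q unfolding l_def l'_def by (intro tendsto_intros)
    have "(\<lambda>n. snd (z n) /\<^sub>R S n - c n) \<longlonglongrightarrow> 0"
    proof (rule tendsto_norm_zero_cancel, rule tendsto_sandwich[OF _ _ tendsto_const err])
      show "\<forall>\<^sub>F n in sequentially. norm (snd (z n) /\<^sub>R S n - c n) \<le> err n"
      proof (intro always_eventually allI)
        fix n
        have "c n = (1 / S n) *\<^sub>R (a n *\<^sub>R snd (e n) + b n *\<^sub>R snd (f n))"
          using lpos[of n] by (simp add: c_def scaleR_add_right field_simps)
        then have "snd (z n) /\<^sub>R S n - c n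
            = (1 / S n) *\<^sub>R (snd (z n) - a n *\<^sub>R snd (e n) - b n *\<^sub>R snd (f n))"
          by (simp add: algebra_simps divide_inverse)
        then show "norm (snd (z n) /\<^sub>R S n - c n) \<le> err n"
          unfolding err_def using z(3)[of n] Spos[of n]
          by (simp add: divide_right_mono)
      qed
    qed simp
    from tendsto_add[OF this c] show ?thesis by simp
  qed
  have "filterlim S at_top sequentially"
  proof (rule filterlim_at_top_mono)
    show "filterlim (\<lambda>n. l n * l' n) at_top sequentially"
      unfolding l_def l'_def by (rule filterlim_at_top_mult_at_top[OF e(2) f(2)])
    show "\<forall>\<^sub>F n in sequentially. l n * l' n \<le> S n"
      using lpos by (intro always_eventually allI) (simp add: S_def algebra_simps less_imp_le)
  qed
  then have "filterlim (\<lambda>n. fst (z n) / S n * S n) at_top sequentially"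
    using zf by (intro filterlim_tendsto_pos_mult_at_top) auto
  moreover have "fst (z n) / S n * S n = fst (z n)" for n
    using Spos[of n] by simp
  ultimately have "filterlim (\<lambda>n. fst (z n)) at_top sequentially" by simp
  moreover have "(\<lambda>n. snd (z n) /\<^sub>R fst (z n)) \<longlonglongrightarrow> (1 - t) *\<^sub>R w + t *\<^sub>R w'"
  proof -
    have "(\<lambda>n. (snd (z n) /\<^sub>R S n) /\<^sub>R (fst (z n) / S n)) \<longlonglongrightarrow> ((1 - t) *\<^sub>R w + t *\<^sub>R w') /\<^sub>R 1"
      by (intro tendsto_intros zf zs) simp
    moreover have "(snd (z n) /\<^sub>R S n) /\<^sub>R (fst (z n) / S n) = snd (z n) /\<^sub>R fst (z n)" for n
      using Spos[of n] by (simp add: inverse_eq_divide)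
    ultimately show ?thesis by (simp only: inverse_1 scaleR_one)
  qed
  ultimately show "(1 - t) *\<^sub>R w + t *\<^sub>R w' \<in> asymptotic_ratios E"
    unfolding asymptotic_ratios_def using z(1) by blast
qed

section \<open>Normals and reflections\<close>

lemma orthogonal_complement_singleton:
  fixes g u :: "'a::real_inner"
  assumes "g \<noteq> 0" and perp: "\<And>h. g \<bullet> h = 0 \<Longrightarrow> u \<bullet> h = 0"
  shows "u = ((u \<bullet> g) / (g \<bullet> g)) *\<^sub>R g"
proof -
  define c where "c = (u \<bullet> g) / (g \<bullet> g)"
  define h where "h = u - c *\<^sub>R g"
  have gh: "g \<bullet> h = 0"
    using \<open>g \<noteq> 0\<close> by (simp add: h_def c_def inner_diff_right inner_commute)
  then have "u \<bullet> h = 0" by (rule perp)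
  moreover have "h \<bullet> h = u \<bullet> h - c * (g \<bullet> h)"
    unfolding h_def by (simp only: inner_diff_left inner_scaleR_left)
  ultimately have "h = 0" using gh by simp
  then show ?thesis by (simp add: h_def c_def)
qed

text \<open>Moving from \<open>x\<close> along a tangent vector \<open>h\<close>, the intermediate value theorem in the
  direction of the gradient yields points of the frontier at distance \<open>o(s)\<close> from
  \<open>x + s h\<close>; so \<open>u\<close> vanishes on tangent vectors.\<close>

lemma outer_normal_level_set:
  fixes K :: "'a::real_inner set"
  assumes U: "open U" "x \<in> U"
    and f: "continuous_on U f" "(f has_derivative (\<lambda>h. g \<bullet> h)) (at x)" "f x = (0::real)"
    and g: "g \<noteq> 0"
    and front: "\<And>y. y \<in> U \<Longrightarrow> f y = 0 \<Longrightarrow> y \<in> K"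
    and u: "\<And>y. y \<in> K \<Longrightarrow> (y - x) \<bullet> u \<le> 0"
    and h: "g \<bullet> h = 0"
  shows "h \<bullet> u \<le> 0"
proof (rule field_le_epsilon)
  fix e :: real assume e: "0 < e"
  \<comment> \<open>With this choice, a correction \<open>q\<close> along \<open>g\<close> with
    \<open>\<bar>q\<bar> \<le> d\<close> changes the inner product with \<open>u\<close> by at most
    \<open>e\<close>.\<close>
  define d where "d = e / (\<bar>g \<bullet> u\<bar> + 1)"
  have d: "d > 0" using e by (simp add: d_def add_nonneg_pos)
  have der: "((\<lambda>s. f (x + s *\<^sub>R k)) has_real_derivative g \<bullet> k) (at 0)" for k
    unfolding has_field_derivative_def
    by (rule has_derivative_eq_rhs[OF has_derivative_compose[of "\<lambda>s. x + s *\<^sub>R k" "\<lambda>s. s *\<^sub>R k" 0 UNIV f]])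
       (auto intro!: derivative_eq_intros f(2) simp: fun_eq_iff mult.commute)
  have gg: "g \<bullet> g > 0" using g by simp
  obtain r where r: "r > 0" "ball x r \<subseteq> U" using U openE by blast
  obtain d1 where d1: "d1 > 0" "\<And>s. 0 < s \<Longrightarrow> s < d1 \<Longrightarrow> f (x + s *\<^sub>R (h + d *\<^sub>R g)) > 0"
    using DERIV_pos_inc_right[OF der[of "h + d *\<^sub>R g"]] h gg d f(3)
    by (auto simp: inner_add_right)
  obtain d2 where d2: "d2 > 0" "\<And>s. 0 < s \<Longrightarrow> s < d2 \<Longrightarrow> f (x + s *\<^sub>R (h - d *\<^sub>R g)) < 0"
    using DERIV_neg_dec_right[OF der[of "h - d *\<^sub>R g"]] h gg d f(3)
    by (auto simp: inner_diff_right)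
  \<comment> \<open>\<open>M\<close> bounds the norm of every direction searched by the intermediate
    value theorem, so \<open>s * M < r\<close> keeps the whole search inside
    \<open>U\<close>.\<close>
  define M where "M = norm h + d * norm g + 1"
  have M: "M > 0" using d by (simp add: M_def add_nonneg_pos)
  define s where "s = min (min (d1/2) (d2/2)) (r / (2 * M))"
  have s: "0 < s" "s < d1" "s < d2" "s * M < r"
  proof -
    show "0 < s" "s < d1" "s < d2" using d1 d2 r M by (auto simp: s_def)
    have "s * M \<le> r / (2 * M) * M" using M by (intro mult_right_mono) (auto simp: s_def)
    then show "s * M < r" using M r by simp
  qed
  have inU: "x + s *\<^sub>R (h + q *\<^sub>R g) \<in> U" if "\<bar>q\<bar> \<le> d" for q
  proof -
    have "norm (h + q *\<^sub>R g) \<le> norm h + d * norm g"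
      using that by (intro norm_triangle_le add_left_mono) (auto intro: mult_right_mono)
    then have "norm (h + q *\<^sub>R g) \<le> M" by (simp add: M_def)
    then have "s * norm (h + q *\<^sub>R g) \<le> s * M" using s(1) by simp
    moreover have "dist x (x + s *\<^sub>R (h + q *\<^sub>R g)) = s * norm (h + q *\<^sub>R g)"
      using s(1) by (simp add: dist_norm)
    ultimately have "dist x (x + s *\<^sub>R (h + q *\<^sub>R g)) < r" using s(4) by linarith
    then show ?thesis using r by auto
  qed
  have "\<exists>q\<ge>-d. q \<le> d \<and> f (x + s *\<^sub>R (h + q *\<^sub>R g)) = 0"
  proof (rule IVT')
    show "f (x + s *\<^sub>R (h + - d *\<^sub>R g)) \<le> 0" using d2(2)[of s] s by simp
    show "0 \<le> f (x + s *\<^sub>R (h + d *\<^sub>R g))" using d1(2)[of s] s by simp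
    show "continuous_on {- d..d} (\<lambda>q. f (x + s *\<^sub>R (h + q *\<^sub>R g)))"
      by (rule continuous_on_compose2[OF f(1)]) (auto intro!: continuous_intros inU)
  qed (use d in auto)
  then obtain q where "- d \<le> q" "q \<le> d" and q0: "f (x + s *\<^sub>R (h + q *\<^sub>R g)) = 0" by blast
  then have q: "\<bar>q\<bar> \<le> d" "f (x + s *\<^sub>R (h + q *\<^sub>R g)) = 0" by auto
  from u[OF front[OF inU[OF q(1)] q(2)]] s(1)
  have "(h + q *\<^sub>R g) \<bullet> u \<le> 0" by (simp add: mult_le_0_iff)
  then have "h \<bullet> u \<le> - q * (g \<bullet> u)" by (simp add: inner_add_left)
  also have "\<dots> \<le> \<bar>q\<bar> * \<bar>g \<bullet> u\<bar>" using abs_ge_self[of "- q * (g \<bullet> u)"] by (simp add: abs_mult)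
  also have "\<dots> \<le> d * (\<bar>g \<bullet> u\<bar> + 1)" using q d by (intro mult_mono) auto
  also have "\<dots> = e" by (simp add: d_def)
  finally show "h \<bullet> u \<le> 0 + e" by simp
qed

text \<open>Both normals annihilate the tangent hyperplane of the defining function, so they are
  multiples of its gradient and agree up to sign. Opposite signs would squeeze \<open>K\<close> into
  a hyperplane, which the interior point excludes.\<close>

lemma outer_unit_normal_unique:
  assumes K: "closed K" "interior K \<noteq> {}" "C2_boundary K"
    and u: "outer_unit_normal K x u" and u': "outer_unit_normal K x u'"
  shows "u = u'"
proof -
  have x: "x \<in> frontier K" using u by (simp add: outer_unit_normal_def)
  obtain U f g H where UfgH: "open U" "x \<in> U"
      "\<forall>y\<in>U. (f has_derivative (\<lambda>h. g y \<bullet> h)) (at y)" "g x \<noteq> 0"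
      "frontier K \<inter> U = {y \<in> U. f y = (0::real)}"
    using bspec[OF K(3)[unfolded C2_boundary_def] x] by (elim exE conjE) (rule that; assumption)
  have cont: "continuous_on U f"
    using UfgH(3) by (meson continuous_at_imp_continuous_on has_derivative_continuous)
  have fx: "f x = 0" using UfgH x by blast
  have frontK: "y \<in> K" if "y \<in> U" "f y = 0" for y
    using UfgH(5) that frontier_subset_closed[OF K(1)] by blast
  \<comment> \<open>The one-sided estimate is applied to \<open>h\<close> and to
    \<open>- h\<close>.\<close>
  have par: "v \<bullet> h = 0" if "outer_unit_normal K x v" "g x \<bullet> h = 0" for v h
  proof -
    have v: "\<And>y. y \<in> K \<Longrightarrow> (y - x) \<bullet> v \<le> 0" using that(1) by (simp add: outer_unit_normal_def)
    have "k \<bullet> v \<le> 0" if "g x \<bullet> k = 0" for k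
      by (rule outer_normal_level_set[OF UfgH(1,2) cont bspec[OF UfgH(3,2)] fx UfgH(4) frontK v that])
    from this[of h] this[of "- h"] that(2) show ?thesis by (simp add: inner_commute)
  qed
  define c where "c v = (v \<bullet> g x) / (g x \<bullet> g x)" for v
  have eq: "u = c u *\<^sub>R g x" "u' = c u' *\<^sub>R g x"
    unfolding c_def using UfgH(4) par u u' by (intro orthogonal_complement_singleton; blast)+
  have "norm u = norm u'" using u u' by (simp add: outer_unit_normal_def)
  then have "\<bar>c u\<bar> = \<bar>c u'\<bar>" using eq UfgH(4) by (metis mult_right_cancel norm_eq_zero norm_scaleR)
  then consider "c u = c u'" | "c u = - c u'" by linarith
  then show ?thesis
  proof cases
    case 1
    then show ?thesis using eq by simp
  next
    case 2
    then have uu: "u = - u'" using eq by (metis scaleR_minus_left)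
    obtain y e where y: "e > 0" "cball y e \<subseteq> K" using K(2) mem_interior_cball by blast
    have "y \<in> K" "y + e *\<^sub>R u \<in> K"
      using y u by (auto simp: subset_iff dist_norm outer_unit_normal_def)
    then have "(y - x) \<bullet> u \<ge> 0" "(y + e *\<^sub>R u - x) \<bullet> u \<le> 0"
      using u u' uu by (auto simp: outer_unit_normal_def)
    moreover have "u \<bullet> u = 1" using u by (simp add: outer_unit_normal_def norm_eq_sqrt_inner)
    then have "(y + e *\<^sub>R u - x) \<bullet> u = (y - x) \<bullet> u + e"
      by (simp add: inner_add_left inner_diff_left)
    ultimately show ?thesis using y(1) by simp
  qed
qed

text \<open>Otherwise a hyperplane separates the interior from the ray, giving a second normal.\<close>

lemma inward_meets_interior:
  assumes K: "convex K" "closed K" "interior K \<noteq> {}" "C2_boundary K"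
    and u: "outer_unit_normal K x u" and d: "d \<bullet> u < 0" and l: "l > 0"
  shows "\<exists>s\<in>{0..l}. x + s *\<^sub>R d \<in> interior K"
proof (rule ccontr)
  assume neg: "\<not> ?thesis"
  define T where "T = closed_segment x (x + l *\<^sub>R d)"
  have "interior K \<inter> T = {}"
  proof -
    have False if z: "z \<in> interior K" "z \<in> T" for z
    proof -
      obtain q where "0 \<le> q" "q \<le> 1" "z = x + (q * l) *\<^sub>R d"
        using z(2) by (auto simp: T_def in_segment algebra_simps)
      then show False using neg z(1) l by (auto simp: mult_left_le_one_le)
    qed
    then show ?thesis by blast
  qed
  then obtain a b where a: "a \<noteq> 0" "\<forall>y\<in>interior K. a \<bullet> y \<le> b" "\<forall>y\<in>T. a \<bullet> y \<ge> b"
    using separating_hyperplane_sets[of "interior K" T] K convex_interior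
    by (auto simp: T_def)
  have x: "x \<in> frontier K" using u by (simp add: outer_unit_normal_def)
  have cl: "a \<bullet> y \<le> b" if "y \<in> closure K" for y
  proof -
    have "closure (interior K) \<subseteq> {y. a \<bullet> y \<le> b}"
      using a(2) by (intro closure_minimal closed_halfspace_le) auto
    then show ?thesis using that convex_closure_interior[OF K(1,3)] by auto
  qed
  have "x \<in> closure K" using x by (simp add: frontier_def)
  then have ax: "a \<bullet> x = b" using cl[of x] a(3) by (force simp: T_def)
  have "outer_unit_normal K x (a /\<^sub>R norm a)"
    unfolding outer_unit_normal_def using a(1) x ax cl closure_subset[of K]
    by (auto simp: inner_diff_left inner_commute algebra_simps)
  then have "u = a /\<^sub>R norm a" using outer_unit_normal_unique[OF K(2,3,4) u] by simp
  then have "d \<bullet> a < 0" using d a(1) by (simp add: mult_less_0_iff)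
  moreover have "a \<bullet> (x + l *\<^sub>R d) \<ge> b" using a(3) by (auto simp: T_def)
  ultimately show False using ax mult_pos_neg[OF l, of "d \<bullet> a"]
    by (simp add: inner_add_right inner_commute[of a d])
qed

text \<open>First variation: the vector sum is the gradient at \<open>x\<close> of the sum of
  distances to \<open>a\<close> and \<open>b\<close>. Were its derivative towards \<open>y\<close>
  negative, a short move along the segment, which stays in the convex set, would decrease the
  sum.\<close>

lemma sum_dist_two_points_optimal:
  fixes a b x y :: "'a::real_inner"
  assumes K: "convex K" "x \<in> K" "y \<in> K" and ne: "x \<noteq> a" "x \<noteq> b"
    and opt: "\<And>z. z \<in> K \<Longrightarrow> dist a x + dist x b \<le> dist a z + dist z b"
  shows "0 \<le> (sgn (x - a) + sgn (x - b)) \<bullet> (y - x)"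
proof (rule ccontr)
  assume neg: "\<not> ?thesis"
  define \<phi> where "\<phi> s = norm (x - a + s *\<^sub>R (y - x)) + norm (x - b + s *\<^sub>R (y - x))" for s :: real
  have der: "((\<lambda>s. norm (c + s *\<^sub>R k)) has_real_derivative k \<bullet> sgn c) (at 0)" if "c \<noteq> 0" for c k :: 'a
    unfolding has_field_derivative_def
    by (rule has_derivative_eq_rhs[OF has_derivative_compose[of "\<lambda>s. c + s *\<^sub>R k" "\<lambda>s. s *\<^sub>R k" 0 UNIV norm "\<lambda>h. h \<bullet> sgn c"]])
       (auto intro!: derivative_eq_intros has_derivative_norm that simp: fun_eq_iff mult.commute)
  have "(\<phi> has_real_derivative (y - x) \<bullet> sgn (x - a) + (y - x) \<bullet> sgn (x - b)) (at 0)"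
    unfolding \<phi>_def using ne by (intro DERIV_add der) auto
  moreover have "(y - x) \<bullet> sgn (x - a) + (y - x) \<bullet> sgn (x - b) < 0"
    using neg by (simp add: inner_add_right inner_commute[of _ "y - x"])
  ultimately obtain d where d: "d > 0" "\<And>h. 0 < h \<Longrightarrow> h < d \<Longrightarrow> \<phi> 0 > \<phi> (0 + h)"
    using DERIV_neg_dec_right by blast
  define s where "s = min (d / 2) 1"
  have s: "0 < s" "s < d" "s \<le> 1" using d(1) by (auto simp: s_def)
  have "x + s *\<^sub>R (y - x) = (1 - s) *\<^sub>R x + s *\<^sub>R y" by (simp add: algebra_simps)
  then have "x + s *\<^sub>R (y - x) \<in> K" using K s by (auto intro!: convexD_alt)
  from opt[OF this] have "\<phi> 0 \<le> \<phi> s"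
    unfolding dist_commute[of a] by (simp add: \<phi>_def dist_norm algebra_simps)
  then show False using d(2)[of s] s by simp
qed

lemma supporting_point_frontier:
  fixes K :: "'a::real_inner set"
  assumes "x \<in> K" "u \<noteq> 0" "\<And>y. y \<in> K \<Longrightarrow> (y - x) \<bullet> u \<le> 0"
  shows "x \<in> frontier K"
proof -
  have "x \<notin> interior K"
  proof
    assume "x \<in> interior K"
    then obtain e where e: "e > 0" "cball x e \<subseteq> K" using mem_interior_cball by blast
    have "x + (e / norm u) *\<^sub>R u \<in> K" using e assms(2) by (auto simp: subset_iff dist_norm)
    from assms(3)[OF this] have "(e / norm u) * (u \<bullet> u) \<le> 0" by simp
    moreover have "(e / norm u) * (u \<bullet> u) > 0" using e assms(2) by simp
    ultimately show False by linarith
  qed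
  then show ?thesis using assms(1) closure_subset by (auto simp: frontier_def)
qed

text \<open>The mirror orthogonal to \<open>w - v\<close> exchanges the unit vectors
  \<open>v\<close> and \<open>w\<close>. Hence the reflection law only requires \<open>w - v\<close>
  to be an outward normal direction.\<close>

lemma reflects_of_difference:
  assumes "x \<in> K" "norm v = 1" "norm w = 1" "v \<noteq> w" "\<And>y. y \<in> K \<Longrightarrow> (y - x) \<bullet> (w - v) \<le> 0"
  shows "reflects K x v w"
proof -
  define n where "n = norm (w - v)"
  have n: "n > 0" using assms(4) by (simp add: n_def)
  have vv: "v \<bullet> v = 1" "w \<bullet> w = 1" using assms(2,3) by (simp_all add: norm_eq_sqrt_inner)
  have n2: "n * n = 2 - 2 * (v \<bullet> w)"
  proof -
    have "n * n = (w - v) \<bullet> (w - v)" by (simp add: n_def norm_eq_sqrt_inner)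
    then show ?thesis by (simp add: inner_diff_left inner_diff_right inner_commute[of w v] vv)
  qed
  have "outer_unit_normal K x ((w - v) /\<^sub>R n)"
    unfolding outer_unit_normal_def
    using supporting_point_frontier[of x K "w - v"] assms n
    by (auto simp: n_def mult_le_0_iff)
  moreover have "w = v - (2 * (v \<bullet> ((w - v) /\<^sub>R n))) *\<^sub>R ((w - v) /\<^sub>R n)"
  proof -
    have "(2 * (v \<bullet> ((w - v) /\<^sub>R n))) / n = 2 * (v \<bullet> w - 1) / (n * n)"
      using vv n by (simp add: inner_diff_right divide_simps)
    also have "\<dots> = -1" using n n2 by (simp add: field_simps)
    finally have "(2 * (v \<bullet> ((w - v) /\<^sub>R n))) *\<^sub>R ((w - v) /\<^sub>R n) = (-1) *\<^sub>R (w - v)"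
      unfolding scaleR_scaleR by (simp only: divide_inverse)
    then show ?thesis by simp
  qed
  ultimately show ?thesis unfolding reflects_def by blast
qed

text \<open>A calibration argument: \<open>l n\<close> is the inner product of \<open>v n\<close>
  with the \<open>n\<close>-th edge, and replacing the edge of \<open>x\<close> by that of
  \<open>y\<close> only costs inner products with \<open>y - x\<close> at its two ends. At inner
  vertices these combine to a term whose sign is given by \<open>turn\<close>; the two outermost
  ones are bounded by Cauchy-Schwarz.\<close>

lemma sum_dist_broken_path:
  fixes x y v :: "nat \<Rightarrow> 'a::real_inner"
  assumes x: "\<And>n. n < p \<Longrightarrow> x (Suc n) = x n + l n *\<^sub>R v n" and v: "\<And>n. n < p \<Longrightarrow> norm (v n) = 1"
    and turn: "\<And>n. Suc n < p \<Longrightarrow> 0 \<le> (v n - v (Suc n)) \<bullet> (y (Suc n) - x (Suc n))"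
  shows "(\<Sum>n<p. l n) \<le> (\<Sum>n<p. dist (y n) (y (Suc n))) + dist (x 0) (y 0) + dist (x p) (y p)"
proof (cases p)
  case 0
  then show ?thesis by simp
next
  case (Suc q)
  have step: "l n \<le> dist (y n) (y (Suc n)) - v n \<bullet> (y (Suc n) - x (Suc n)) + v n \<bullet> (y n - x n)"
    if "n < p" for n
  proof -
    have "v n \<bullet> v n = 1" using v[OF that] by (simp add: norm_eq_sqrt_inner)
    then have "l n = v n \<bullet> (y (Suc n) - y n) - v n \<bullet> (y (Suc n) - x (Suc n)) + v n \<bullet> (y n - x n)"
      using x[OF that] by (simp add: inner_add_right inner_diff_right)
    moreover have "v n \<bullet> (y (Suc n) - y n) \<le> dist (y n) (y (Suc n))"
      using norm_cauchy_schwarz[of "v n" "y (Suc n) - y n"] v[OF that]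
      by (simp add: dist_norm norm_minus_commute)
    ultimately show ?thesis by linarith
  qed
  have cs: "\<bar>v n \<bullet> z\<bar> \<le> norm z" if "n < p" for n z
    using Cauchy_Schwarz_ineq2[of "v n" z] v[OF that] by simp
  \<comment> \<open>The term at the current last vertex is not estimated yet: together with the
    first term of the next edge it forms the expression in \<open>turn\<close>.\<close>
  have "(\<Sum>n<Suc k. l n) \<le> (\<Sum>n<Suc k. dist (y n) (y (Suc n))) + dist (x 0) (y 0)
      - v k \<bullet> (y (Suc k) - x (Suc k))" if "k < p" for k
    using that
  proof (induction k)
    case 0
    then show ?case using step[of 0] cs[of 0 "y 0 - x 0"] by (simp add: dist_norm norm_minus_commute)
  next
    case (Suc k)
    then show ?case using step[of "Suc k"] turn[of k] by (simp add: inner_diff_left)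
  qed
  from this[of q] Suc cs[of q "y p - x p"] show ?thesis
    by (simp add: dist_norm norm_minus_commute)
qed

section \<open>Shortest broken lines\<close>

text \<open>Tychonoff. Using infinite sequences avoids tuples whose length depends on
  \<open>p\<close>; \<open>broken_length p\<close> looks at the first \<open>p + 1\<close> entries
  only.\<close>

lemma compact_sequences:
  fixes S :: "nat \<Rightarrow> 'a::topological_space set"
  assumes "\<And>n. compact (S n)"
  shows "compact {x. \<forall>n. x n \<in> S n}"
proof -
  have "compactin (product_topology (\<lambda>_. euclidean) UNIV) (PiE UNIV S)"
    unfolding compactin_PiE using assms by simp
  moreover have "PiE UNIV S = {x. \<forall>n. x n \<in> S n}" by (auto simp: PiE_UNIV_domain)
  ultimately show ?thesis by (simp add: euclidean_product_topology)
qed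

definition broken_length :: "nat \<Rightarrow> (nat \<Rightarrow> 'a::metric_space) \<Rightarrow> real" where
  "broken_length p x = (\<Sum>n<p. dist (x n) (x (Suc n)))"

lemma shortest_broken_path:
  fixes S :: "nat \<Rightarrow> 'a::metric_space set"
  assumes "\<And>n. compact (S n)" "\<And>n. S n \<noteq> {}"
  obtains x where "\<And>n. x n \<in> S n"
    "\<And>y. (\<And>n. y n \<in> S n) \<Longrightarrow> broken_length p x \<le> broken_length p y"
proof -
  have "continuous_on {x. \<forall>n. x n \<in> S n} (broken_length p)"
    unfolding broken_length_def
    by (intro continuous_intros continuous_on_subset[OF continuous_on_product_coordinates] subset_UNIV)
  moreover have "{x. \<forall>n. x n \<in> S n} \<noteq> {}"
    using assms(2) choice[of "\<lambda>n x. x \<in> S n"] by blast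
  ultimately obtain x where "x \<in> {x. \<forall>n. x n \<in> S n}"
    "\<forall>y\<in>{x. \<forall>n. x n \<in> S n}. broken_length p x \<le> broken_length p y"
    using continuous_attains_inf[OF compact_sequences[of S, OF assms(1)]] by blast
  then show ?thesis using that[of x] by auto
qed

lemma broken_length_split:
  assumes "finite A" "A \<subseteq> {..<p}"
  shows "broken_length p x = (\<Sum>n\<in>{..<p} - A. dist (x n) (x (Suc n))) + (\<Sum>n\<in>A. dist (x n) (x (Suc n)))"
  unfolding broken_length_def using assms by (intro sum.subset_diff) auto

text \<open>Turns global minimality into a local statement: the summands outside \<open>A\<close> do
  not involve position \<open>j\<close> and cancel.\<close>

lemma broken_length_update:
  assumes "broken_length p x \<le> broken_length p (x(j := z))" "A \<subseteq> {..<p}"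
    and "\<And>n. n < p \<Longrightarrow> n \<notin> A \<Longrightarrow> n \<noteq> j \<and> Suc n \<noteq> j"
  shows "(\<Sum>n\<in>A. dist (x n) (x (Suc n))) \<le> (\<Sum>n\<in>A. dist ((x(j := z)) n) ((x(j := z)) (Suc n)))"
proof -
  have "finite A" using assms(2) finite_subset by blast
  moreover have "(\<Sum>n\<in>{..<p} - A. dist ((x(j := z)) n) ((x(j := z)) (Suc n)))
      = (\<Sum>n\<in>{..<p} - A. dist (x n) (x (Suc n)))"
    using assms(3) by (intro sum.cong) auto
  ultimately show ?thesis
    using assms(1) broken_length_split[OF _ assms(2), of x] broken_length_split[OF _ assms(2), of "x(j := z)"]
    by simp
qed

lemma unit_vectors_inner_less:
  fixes v w :: "'a::real_inner"
  assumes "norm v = 1" "norm w = 1" "v \<noteq> w"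
  shows "v \<bullet> w < 1"
proof -
  have "0 < (v - w) \<bullet> (v - w)" using assms(3) by simp
  moreover have "v \<bullet> v = 1" "w \<bullet> w = 1" using assms(1,2) by (simp_all add: norm_eq_sqrt_inner)
  ultimately show ?thesis by (simp add: inner_diff_left inner_diff_right inner_commute)
qed

lemma norm_scaleR_sgn: "norm x *\<^sub>R sgn x = x"
  by (cases "x = 0") (simp_all add: sgn_div_norm)

lemma sgn_eq_imp_between:
  fixes a x b :: "'a::real_normed_vector"
  assumes "x \<noteq> a" "b \<noteq> x" "sgn (x - a) = sgn (b - x)"
  shows "x \<in> closed_segment a b"
proof -
  define l m where "l = norm (x - a)" and "m = norm (b - x)"
  have lm: "l > 0" "m > 0" using assms by (auto simp: l_def m_def)
  define e where "e = sgn (x - a)"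
  have xa: "x - a = l *\<^sub>R e" by (simp add: e_def l_def norm_scaleR_sgn)
  have xb: "b - x = m *\<^sub>R e" unfolding e_def assms(3) by (simp add: m_def norm_scaleR_sgn)
  have "b - a = (x - a) + (b - x)" by simp
  also have "\<dots> = (l + m) *\<^sub>R e" by (simp only: xa xb scaleR_add_left)
  finally have "b - a = (l + m) *\<^sub>R e" .
  then have "(l / (l + m)) *\<^sub>R (b - a) = l *\<^sub>R e" using lm by simp
  then have "x = a + (l / (l + m)) *\<^sub>R (b - a)" using xa by (simp add: algebra_simps)
  then show ?thesis
    using lm by (auto simp: in_segment algebra_simps intro!: exI[of _ "l / (l + m)"])
qed

text \<open>\<open>x\<close> minimises \<open>broken_length p\<close>. The last two conclusions give
  supporting half-spaces that each edge leaves at its start and meets from outside at its end; they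
  keep the open edges out of the two sets they join.\<close>

lemma billiard_path_exists:
  fixes S :: "nat \<Rightarrow> 'a::euclidean_space set"
  assumes cpt: "\<And>n. compact (S n)" and conv: "\<And>n. convex (S n)" and ne: "\<And>n. S n \<noteq> {}"
    and p: "0 < p" and disj: "\<And>n. n < p \<Longrightarrow> S n \<inter> S (Suc n) = {}"
    and hull: "\<And>n. Suc n < p \<Longrightarrow> S (Suc n) \<inter> convex hull (S n \<union> S (Suc (Suc n))) = {}"
  obtains x v where
    "\<And>n. x n \<in> S n"
    "\<And>n. n < p \<Longrightarrow> x n \<noteq> x (Suc n)"
    "\<And>n. v n = sgn (x (Suc n) - x n)"
    "\<And>n. Suc n < p \<Longrightarrow> v n \<noteq> v (Suc n)"
    "\<And>n y. Suc n < p \<Longrightarrow> y \<in> S (Suc n) \<Longrightarrow> (y - x (Suc n)) \<bullet> (v (Suc n) - v n) \<le> 0"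
    "\<And>n. n < p \<Longrightarrow> \<exists>u. (\<forall>y\<in>S n. (y - x n) \<bullet> u \<le> 0) \<and> (x (Suc n) - x n) \<bullet> u > 0"
    "\<And>n. n < p \<Longrightarrow> \<exists>u. (\<forall>y\<in>S (Suc n). (y - x (Suc n)) \<bullet> u \<le> 0) \<and> (x (Suc n) - x n) \<bullet> u < 0"
proof -
  obtain x where x: "\<And>n. x n \<in> S n"
    and opt: "\<And>y. (\<And>n. y n \<in> S n) \<Longrightarrow> broken_length p x \<le> broken_length p y"
    using shortest_broken_path[of S p, OF cpt ne] by blast
  define v where "v n = sgn (x (Suc n) - x n)" for n
  have upd: "broken_length p x \<le> broken_length p (x(j := z))" if "z \<in> S j" for j z
    using that x by (intro opt) auto
  have xne: "x n \<noteq> x (Suc n)" if "n < p" for n using disj[OF that] x by fastforce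
  have nv: "norm (v n) = 1" if "n < p" for n
    using xne[OF that] by (simp add: v_def norm_sgn)
  have xv: "x (Suc n) - x n = norm (x (Suc n) - x n) *\<^sub>R v n" for n
    by (simp add: v_def norm_scaleR_sgn)
  \<comment> \<open>Equal directions would put the middle vertex on the segment between its
    neighbours, contrary to the hull hypothesis.\<close>
  have vne: "v n \<noteq> v (Suc n)" if n: "Suc n < p" for n
  proof
    assume "v n = v (Suc n)"
    then have "x (Suc n) \<in> closed_segment (x n) (x (Suc (Suc n)))"
      using xne[of n] xne[of "Suc n"] n by (intro sgn_eq_imp_between) (auto simp: v_def)
    moreover have "closed_segment (x n) (x (Suc (Suc n))) \<subseteq> convex hull (S n \<union> S (Suc (Suc n)))"
      unfolding segment_convex_hull using x by (intro hull_mono) auto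
    ultimately show False using hull[OF n] x by blast
  qed
  have norm: "(y - x (Suc n)) \<bullet> (v (Suc n) - v n) \<le> 0" if n: "Suc n < p" and y: "y \<in> S (Suc n)" for n y
  proof -
    have "0 \<le> (sgn (x (Suc n) - x n) + sgn (x (Suc n) - x (Suc (Suc n)))) \<bullet> (y - x (Suc n))"
    proof (rule sum_dist_two_points_optimal[OF conv x y])
      show "x (Suc n) \<noteq> x n" "x (Suc n) \<noteq> x (Suc (Suc n))"
        using xne[of n] xne[of "Suc n"] n by auto
    next
      fix z assume "z \<in> S (Suc n)"
      from broken_length_update[OF upd[OF this], of "{n, Suc n}"] n
      show "dist (x n) (x (Suc n)) + dist (x (Suc n)) (x (Suc (Suc n)))
          \<le> dist (x n) z + dist z (x (Suc (Suc n)))" by auto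
    qed
    moreover have "sgn (x (Suc n) - x (Suc (Suc n))) = - v (Suc n)"
      by (metis v_def minus_diff_eq sgn_minus)
    ultimately have "0 \<le> (v n - v (Suc n)) \<bullet> (y - x (Suc n))" by (simp add: v_def)
    then show ?thesis by (simp add: inner_diff_left inner_diff_right inner_commute)
  qed
  have inner_less: "v n \<bullet> v (Suc n) < 1" if "Suc n < p" for n
    using that nv vne by (intro unit_vectors_inner_less) auto
  have vv: "v n \<bullet> v n = 1" if "n < p" for n using nv[OF that] by (simp add: norm_eq_sqrt_inner)
  \<comment> \<open>At an inner vertex the supporting direction is the change of velocity, and
    strictness comes from the two velocities being distinct unit vectors. At the free initial vertex
    it comes from \<open>x 0\<close> being the point of \<open>S 0\<close> nearest to
    \<open>x 1\<close>.\<close>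
  have out: "\<exists>u. (\<forall>y\<in>S n. (y - x n) \<bullet> u \<le> 0) \<and> (x (Suc n) - x n) \<bullet> u > 0" if n: "n < p" for n
  proof (cases n)
    case 0
    have "(x 1 - x 0) \<bullet> (y - x 0) \<le> 0" if "y \<in> S 0" for y
    proof (rule any_closest_point_dot[OF conv compact_imp_closed[OF cpt] x that])
      have "dist (x 0) (x 1) \<le> dist z (x 1)" if "z \<in> S 0" for z
        using broken_length_update[OF upd[OF that], of "{0}"] p by auto
      then show "\<forall>z\<in>S 0. dist (x 1) (x 0) \<le> dist (x 1) z" by (simp add: dist_commute)
    qed
    then show ?thesis
      using xne[OF p] 0 by (intro exI[of _ "x 1 - x 0"]) (auto simp: inner_commute)
  next
    case (Suc m)
    have "v n \<bullet> (v n - v m) > 0"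
      using inner_less[of m] vv[OF n] n Suc by (simp add: inner_diff_right inner_commute)
    then have "(x (Suc n) - x n) \<bullet> (v n - v m) > 0"
      using xne[OF n] by (subst xv) simp
    then show ?thesis using norm[of m] n Suc by blast
  qed
  have inn: "\<exists>u. (\<forall>y\<in>S (Suc n). (y - x (Suc n)) \<bullet> u \<le> 0) \<and> (x (Suc n) - x n) \<bullet> u < 0" if n: "n < p" for n
  proof (cases "Suc n = p")
    case True
    have "(x n - x (Suc n)) \<bullet> (y - x (Suc n)) \<le> 0" if "y \<in> S (Suc n)" for y
    proof (rule any_closest_point_dot[OF conv compact_imp_closed[OF cpt] x that])
      have "dist (x n) (x (Suc n)) \<le> dist (x n) z" if "z \<in> S (Suc n)" for z
        using broken_length_update[OF upd[OF that], of "{n}"] True by auto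
      then show "\<forall>z\<in>S (Suc n). dist (x n) (x (Suc n)) \<le> dist (x n) z" by simp
    qed
    moreover have "(x (Suc n) - x n) \<bullet> (x n - x (Suc n)) < 0"
    proof -
      have "(x (Suc n) - x n) \<bullet> (x n - x (Suc n)) = - ((x (Suc n) - x n) \<bullet> (x (Suc n) - x n))"
        by (simp add: inner_diff_right)
      then show ?thesis using xne[OF n] by simp
    qed
    ultimately show ?thesis by (metis inner_commute)
  next
    case False
    then have n': "Suc n < p" using n by simp
    have "v n \<bullet> (v (Suc n) - v n) < 0"
      using inner_less[OF n'] vv[OF n] by (simp add: inner_diff_right)
    then have "(x (Suc n) - x n) \<bullet> (v (Suc n) - v n) < 0"
      using xne[OF n] by (subst xv) (simp add: mult_less_0_iff)
    then show ?thesis using norm[OF n'] by blast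
  qed
  show thesis
    by (rule that[of x v]) (use x xne v_def vne norm out inn in auto)
qed

text \<open>The value at \<open>\<tau> n\<close> is stated separately because for \<open>p = 0\<close> there are no pieces.\<close>

lemma piecewise_linear_curve:
  fixes x v :: "nat \<Rightarrow> 'a::real_vector" and \<tau> :: "nat \<Rightarrow> real"
  assumes "\<And>n. n < p \<Longrightarrow> \<tau> n < \<tau> (Suc n)"
    and "\<And>n. n < p \<Longrightarrow> x (Suc n) = x n + (\<tau> (Suc n) - \<tau> n) *\<^sub>R v n"
  shows "\<exists>\<gamma>. (\<forall>n\<le>p. \<gamma> (\<tau> n) = x n) \<and>
     (\<forall>n<p. \<forall>t\<in>{\<tau> n..\<tau> (Suc n)}. \<gamma> t = x n + (t - \<tau> n) *\<^sub>R v n)"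
  using assms
proof (induction p)
  case 0
  show ?case by (rule exI[of _ "\<lambda>_. x 0"]) simp
next
  case (Suc p)
  then obtain \<gamma> where \<gamma>: "\<forall>n\<le>p. \<gamma> (\<tau> n) = x n"
    "\<forall>n<p. \<forall>t\<in>{\<tau> n..\<tau> (Suc n)}. \<gamma> t = x n + (t - \<tau> n) *\<^sub>R v n"
    by (metis less_SucI)
  have mono: "\<tau> n \<le> \<tau> p" if "n \<le> p" for n
    using that
  proof (induction rule: inc_induct)
    case (step k)
    then show ?case using Suc.prems(1)[of k] by simp
  qed simp
  define \<delta> where "\<delta> t = (if t \<le> \<tau> p then \<gamma> t else x p + (t - \<tau> p) *\<^sub>R v p)" for t
  have "\<delta> (\<tau> n) = x n" if "n \<le> Suc p" for n
  proof (cases "n = Suc p")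
    case True
    then show ?thesis using Suc.prems[of p] by (simp add: \<delta>_def)
  next
    case False
    then show ?thesis using that mono \<gamma>(1) by (simp add: \<delta>_def)
  qed
  moreover have "\<delta> t = x n + (t - \<tau> n) *\<^sub>R v n" if "n < Suc p" "t \<in> {\<tau> n..\<tau> (Suc n)}" for n t
  proof (cases "n = p")
    case True
    then show ?thesis using that \<gamma>(1) by (cases "t = \<tau> p") (auto simp: \<delta>_def)
  next
    case False
    then show ?thesis using that mono[of "Suc n"] \<gamma>(2) by (simp add: \<delta>_def)
  qed
  ultimately show ?case by blast
qed

section \<open>Obstacles in Euclidean space\<close>

definition shift :: "int ^ 'm \<Rightarrow> (int ^ 'm) \<times> 'n \<Rightarrow> (int ^ 'm) \<times> 'n" where
  "shift k q = (k + fst q, snd q)"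

lemma shift_simps [simp]: "fst (shift k q) = k + fst q" "snd (shift k q) = snd q"
  by (simp_all add: shift_def)

lemma shift_shift [simp]: "shift k (shift l q) = shift (k + l) q"
  by (simp add: shift_def add.assoc)

lemma shift_0 [simp]: "shift 0 q = q"
  by (simp add: shift_def)

lemma shift_inject [simp]: "shift k a = shift k b \<longleftrightarrow> a = b"
  by (auto simp: shift_def prod_eq_iff)

lemma int_vec_nth [simp]: "int_vec k $ i = of_int (k $ i)"
  by (simp add: int_vec_def)

lemma int_vec_simps [simp]:
  "int_vec 0 = 0" "int_vec (k + l) = int_vec k + int_vec l"
  "int_vec (k - l) = int_vec k - int_vec l" "int_vec (- k) = - int_vec k"
  by (simp_all add: vec_eq_iff)

lemma mem_obstacle: "x \<in> obstacle Ob q \<longleftrightarrow> x - int_vec (fst q) \<in> base_obstacle Ob (snd q)"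
  by (force simp: obstacle_def)

lemma obstacle_shift: "obstacle Ob (shift k q) = (+) (int_vec k) ` obstacle Ob q"
proof (intro equalityI subsetI)
  fix x assume "x \<in> obstacle Ob (shift k q)"
  then have "x - int_vec k \<in> obstacle Ob q" by (simp add: mem_obstacle diff_diff_eq)
  then show "x \<in> (+) (int_vec k) ` obstacle Ob q" by (force intro: image_eqI[of _ _ "x - int_vec k"])
qed (auto simp: mem_obstacle algebra_simps)

lemma obstacle_between_shift [simp]:
  "obstacle_between Ob (shift k q) (shift k a) (shift k b) \<longleftrightarrow> obstacle_between Ob q a b"
proof -
  have "obstacle Ob (shift k q) \<inter> convex hull (obstacle Ob (shift k a) \<union> obstacle Ob (shift k b))
      = (+) (int_vec k) ` (obstacle Ob q \<inter> convex hull (obstacle Ob a \<union> obstacle Ob b))"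
    by (simp add: obstacle_shift image_Int convex_hull_translation flip: image_Un)
  then show ?thesis by (simp add: obstacle_between_def)
qed

lemma obstacle_between_commute: "obstacle_between Ob q a b \<longleftrightarrow> obstacle_between Ob q b a"
  by (auto simp: obstacle_between_def Un_commute)

section \<open>Visibility and admissible sequences as lists\<close>

definition visible :: "('n \<Rightarrow> ('m::finite) torus set) \<Rightarrow> (int ^ 'm) \<times> 'n \<Rightarrow> (int ^ 'm) \<times> 'n \<Rightarrow> bool"
  where "visible Ob a b \<longleftrightarrow> a \<noteq> b \<and> (\<nexists>q. obstacle_between Ob q a b)"

lemma visible_shift [simp]: "visible Ob (shift k a) (shift k b) \<longleftrightarrow> visible Ob a b"
proof -
  have "(\<exists>q. obstacle_between Ob q (shift k a) (shift k b)) \<longleftrightarrow> (\<exists>q. obstacle_between Ob q a b)"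
    by (metis obstacle_between_shift shift_shift shift_0 add.right_inverse)
  then show ?thesis by (simp add: visible_def)
qed

lemma visible_commute: "visible Ob a b \<longleftrightarrow> visible Ob b a"
  by (auto simp: visible_def obstacle_between_commute)

text \<open>Lists make concatenation easy. The normalisation of the first cell is left out, so that
  the notion is invariant under lattice translations.\<close>

fun admissible_list :: "('n \<Rightarrow> ('m::finite) torus set) \<Rightarrow> ((int ^ 'm) \<times> 'n) list \<Rightarrow> bool" where
  "admissible_list Ob (a # b # c # xs) \<longleftrightarrow>
     visible Ob a b \<and> \<not> obstacle_between Ob b a c \<and> admissible_list Ob (b # c # xs)"
| "admissible_list Ob [a, b] \<longleftrightarrow> visible Ob a b"
| "admissible_list Ob _ \<longleftrightarrow> True"

text \<open>An overlap of two entries suffices, because every condition concerns at most three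
  consecutive entries.\<close>

lemma admissible_list_append:
  "admissible_list Ob (xs @ [a, b]) \<Longrightarrow> admissible_list Ob (a # b # ys) \<Longrightarrow>
     admissible_list Ob (xs @ a # b # ys)"
proof (induction xs)
  case (Cons x xs)
  then show ?case by (cases xs; cases "tl xs") auto
qed simp

lemma admissible_list_map_shift [simp]:
  "admissible_list Ob (map (shift k) xs) \<longleftrightarrow> admissible_list Ob xs"
  by (induction Ob xs rule: admissible_list.induct) auto

lemma admissible_list_iff_nth:
  "admissible_list Ob xs \<longleftrightarrow>
     (\<forall>n. Suc n < length xs \<longrightarrow> visible Ob (xs ! n) (xs ! Suc n)) \<and>
     (\<forall>n. Suc (Suc n) < length xs \<longrightarrow> \<not> obstacle_between Ob (xs ! Suc n) (xs ! n) (xs ! Suc (Suc n)))"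
proof (induction Ob xs rule: admissible_list.induct)
  case (1 Ob a b c xs)
  have all_nat: "(\<forall>n. P n) \<longleftrightarrow> P 0 \<and> (\<forall>n. P (Suc n))" for P
    by (metis not0_implies_Suc)
  have "(\<forall>n. Suc n < length (a # b # c # xs) \<longrightarrow>
        visible Ob ((a # b # c # xs) ! n) ((a # b # c # xs) ! Suc n)) \<longleftrightarrow>
      visible Ob a b \<and> (\<forall>n. Suc n < length (b # c # xs) \<longrightarrow>
        visible Ob ((b # c # xs) ! n) ((b # c # xs) ! Suc n))"
    by (subst all_nat) simp
  moreover have "(\<forall>n. Suc (Suc n) < length (a # b # c # xs) \<longrightarrow>
        \<not> obstacle_between Ob ((a # b # c # xs) ! Suc n) ((a # b # c # xs) ! n)
          ((a # b # c # xs) ! Suc (Suc n))) \<longleftrightarrow>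
      \<not> obstacle_between Ob b a c \<and> (\<forall>n. Suc (Suc n) < length (b # c # xs) \<longrightarrow>
        \<not> obstacle_between Ob ((b # c # xs) ! Suc n) ((b # c # xs) ! n)
          ((b # c # xs) ! Suc (Suc n)))"
    by (subst all_nat) simp
  ultimately show ?case using 1 by (simp only: admissible_list.simps) blast
qed (auto simp: less_Suc_eq)

lemma admissible_iff_list:
  "admissible Ob p \<sigma> \<longleftrightarrow> fst (\<sigma> 0) = 0 \<and> admissible_list Ob (map \<sigma> [0..<Suc p])"
proof -
  have "admissible_list Ob (map \<sigma> [0..<Suc p]) \<longleftrightarrow>
     (\<forall>n<p. visible Ob (\<sigma> n) (\<sigma> (Suc n))) \<and>
     (\<forall>n. Suc n < p \<longrightarrow> \<not> obstacle_between Ob (\<sigma> (Suc n)) (\<sigma> n) (\<sigma> (Suc (Suc n))))"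
    unfolding admissible_list_iff_nth by (auto simp: nth_append simp del: upt_Suc)
  then show ?thesis
    by (auto simp: admissible_def visible_def)
qed

lemma convex_hull_component:
  fixes A :: "(real ^ 'm) set"
  assumes "convex T" "\<And>z. z \<in> A \<Longrightarrow> z $ i \<in> T" "z \<in> convex hull A"
  shows "z $ i \<in> T"
proof -
  have "convex ((\<lambda>z::real ^ 'm. z $ i) -` T)"
    by (intro convex_linear_vimage assms(1)) (simp add: linear_iff)
  then have "convex hull A \<subseteq> (\<lambda>z. z $ i) -` T"
    using assms(2) by (intro hull_minimal) auto
  then show ?thesis using assms(3) by blast
qed

text \<open>The Minkowski sum of \<open>K\<close> and the segment from 0 to \<open>w\<close> is
  convex and contains both copies. Hull points are thus points of \<open>K\<close> slid along
  \<open>w\<close>.\<close>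

lemma convex_hull_translate_pair:
  assumes "convex K" "z \<in> convex hull (K \<union> (+) w ` K)"
  shows "\<exists>y\<in>K. \<exists>t. 0 \<le> t \<and> t \<le> 1 \<and> z = y + t *\<^sub>R w"
proof -
  let ?S = "{y + s | y s. y \<in> K \<and> s \<in> closed_segment 0 w}"
  have "convex ?S"
    using convex_sums[OF assms(1) convex_closed_segment[of 0 w]]
    by (rule back_subst[of convex]) blast
  moreover have "K \<union> (+) w ` K \<subseteq> ?S"
    by (auto simp: add.commute) (metis add.right_neutral ends_in_segment(1))
  ultimately have "z \<in> ?S" using assms(2) hull_minimal by blast
  then show ?thesis by (auto simp: in_segment)
qed

definition unit_steps :: "(int ^ 'm) set" where
  "unit_steps = (\<Union>i. {axis i 1, - axis i 1})"

lemma axis_in_unit_steps [simp]: "axis i 1 \<in> unit_steps" "- axis i 1 \<in> unit_steps"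
  by (auto simp: unit_steps_def)

lemma uminus_unit_steps [simp]: "- e \<in> unit_steps \<longleftrightarrow> e \<in> unit_steps"
  unfolding unit_steps_def by (auto simp: minus_equation_iff[of e])

lemma int_vec_axis [simp]: "int_vec (axis i 1) = axis i 1"
  by (auto simp: vec_eq_iff axis_def)

lemma norm_unit_step:
  assumes "e \<in> unit_steps"
  shows "norm (int_vec e) = 1"
  using assms by (auto simp: unit_steps_def)

lemma unit_steps_nonzero: "e \<in> unit_steps \<Longrightarrow> e \<noteq> 0"
  using norm_unit_step by fastforce

lemma unit_steps_orthogonal:
  assumes "e \<in> unit_steps" "f \<in> unit_steps" "e \<noteq> f" "e \<noteq> - f"
  shows "int_vec e \<bullet> int_vec f = 0"
  using assms by (auto simp: unit_steps_def inner_axis_axis)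

locale obstacle_family =
  fixes Ob :: "'n::finite \<Rightarrow> ('m::finite) torus set"
  assumes dimension: "CARD('m) \<ge> 2"
    and standing: "standing_assumptions Ob"
begin

abbreviation B :: "'n \<Rightarrow> (real ^ 'm) set" where "B \<equiv> base_obstacle Ob"
abbreviation Q :: "(int ^ 'm) \<times> 'n \<Rightarrow> (real ^ 'm) set" where "Q \<equiv> obstacle Ob"

lemma base_bounds:
  assumes "x \<in> B r"
  shows "0 < x $ i" "x $ i < 1"
proof -
  have "x \<in> box 0 1" using standing assms interior_cbox[of 0 1]
    unfolding standing_assumptions_def by blast
  then show "0 < x $ i" "x $ i < 1" by (auto simp: mem_box_cart)
qed

lemma base_projections: "x \<in> B r \<Longrightarrow> y \<in> B s \<Longrightarrow> x $ i = y $ i \<Longrightarrow> r = s"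
  using standing unfolding standing_assumptions_def by blast

lemma strictly_convex_base: "strictly_convex_body (B r)"
  using standing unfolding standing_assumptions_def by simp

lemma compact_base: "compact (B r)" and interior_base: "interior (B r) \<noteq> {}"
  using strictly_convex_base unfolding strictly_convex_body_def by auto

lemma base_nonempty: "B r \<noteq> {}"
  using interior_base interior_subset by blast

lemma convex_base: "convex (B r)"
  unfolding convex_contains_open_segment
  using strictly_convex_base[of r] interior_subset[of "B r"] unfolding strictly_convex_body_def
  by (metis (no_types, lifting) empty_subsetI open_segment_idem subset_trans)

lemma base_diameter:
  assumes "x \<in> B r" "y \<in> B r"
  shows "dist x y < sqrt 2 / 4"
proof -
  have "dist x y \<le> diameter (B r)"
    by (intro diameter_bounded_bound compact_imp_bounded compact_base assms)
  also have "\<dots> < sqrt 2 / 4" using standing by (simp add: standing_assumptions_def)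
  finally show ?thesis .
qed

lemma obstacle_translate: "Q q = (+) (int_vec (fst q)) ` B (snd q)"
  by (auto simp: obstacle_def add.commute)

lemma convex_obstacle: "convex (Q q)" and compact_obstacle: "compact (Q q)"
  and obstacle_nonempty: "Q q \<noteq> {}" and interior_obstacle: "interior (Q q) \<noteq> {}"
  unfolding obstacle_translate
  by (simp_all add: convex_translation convex_base compact_translation compact_base base_nonempty
      interior_translation interior_base)

lemma obstacle_diameter: "x \<in> Q q \<Longrightarrow> y \<in> Q q \<Longrightarrow> dist x y < sqrt 2 / 4"
  unfolding mem_obstacle by (drule (1) base_diameter) (simp add: dist_norm)

lemma obstacle_bounds:
  assumes "x \<in> Q q"
  shows "of_int (fst q $ i) < x $ i" "x $ i < of_int (fst q $ i) + 1"
  using base_bounds[of "x - int_vec (fst q)" "snd q" i] assms by (auto simp: mem_obstacle)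

text \<open>Obstacles lie in open unit cells, so one coordinate of a point determines the cell
  number in that direction; assumption (a) then determines the type.\<close>

lemma obstacle_same_component:
  assumes "x \<in> Q a" "y \<in> Q b" "x $ i = y $ i"
  shows "fst a $ i = fst b $ i \<and> snd a = snd b"
proof -
  have "fst a $ i = fst b $ i"
    using obstacle_bounds[OF assms(1), of i] obstacle_bounds[OF assms(2), of i] assms(3) by linarith
  moreover from this have "snd a = snd b"
    using base_projections[of "x - int_vec (fst a)" "snd a" "y - int_vec (fst b)" "snd b" i] assms
    by (auto simp: mem_obstacle)
  ultimately show ?thesis by blast
qed

lemma obstacle_disjoint: "a \<noteq> b \<Longrightarrow> Q a \<inter> Q b = {}"
  by (metis disjoint_iff obstacle_same_component prod_eq_iff vec_eq_iff)

section \<open>Order of obstacles along a coordinate\<close>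

definition below :: "'m \<Rightarrow> (int ^ 'm) \<times> 'n \<Rightarrow> (int ^ 'm) \<times> 'n \<Rightarrow> bool" where
  "below i a b \<longleftrightarrow> (\<forall>x\<in>Q a. \<forall>y\<in>Q b. x $ i < y $ i)"

lemma below_component:
  assumes "fst a $ i < fst b $ i"
  shows "below i a b"
  unfolding below_def
proof (intro ballI)
  fix x y assume "x \<in> Q a" "y \<in> Q b"
  moreover have "real_of_int (fst a $ i) + 1 \<le> of_int (fst b $ i)" using assms by linarith
  ultimately show "x $ i < y $ i"
    using obstacle_bounds(2)[of x a i] obstacle_bounds(1)[of y b i] by linarith
qed

text \<open>The coordinate differences of points of the two convex sets form an interval. If it met
  both sides of 0 it would contain 0, giving two points with a common coordinate, which
  \<open>obstacle_same_component\<close> excludes.\<close>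

lemma below_total:
  assumes "snd a \<noteq> snd b \<or> fst a $ i \<noteq> fst b $ i"
  shows "below i a b \<or> below i b a"
proof (rule ccontr)
  assume "\<not> ?thesis"
  then obtain x x' y y' where xy: "x \<in> Q a" "y \<in> Q b" "x $ i \<le> y $ i"
    "x' \<in> Q a" "y' \<in> Q b" "y' $ i \<le> x' $ i"
    unfolding below_def by (metis not_less)
  define D where "D = (\<lambda>z. z $ i) ` (\<Union>x\<in>Q a. \<Union>y\<in>Q b. {x - y})"
  have "convex D"
    unfolding D_def using convex_differences[OF convex_obstacle convex_obstacle, of b a]
    by (intro convex_linear_image) (auto simp: linear_iff)
  moreover have "x $ i - y $ i \<in> D" "x' $ i - y' $ i \<in> D"
    unfolding D_def using xy
    by (auto intro!: image_eqI[of "x $ i - y $ i" _ "x - y"] image_eqI[of "x' $ i - y' $ i" _ "x' - y'"])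
  ultimately have "0 \<in> D"
    using xy connected_contains_Icc[OF convex_connected, of D "x $ i - y $ i" "x' $ i - y' $ i"]
    by auto
  then obtain u v where "u \<in> Q a" "v \<in> Q b" "u $ i = v $ i" by (auto simp: D_def)
  then show False using obstacle_same_component assms by blast
qed

lemma not_between_below:
  assumes "below i b a \<and> below i b c \<or> below i a b \<and> below i c b"
  shows "\<not> obstacle_between Ob b a c"
proof
  assume "obstacle_between Ob b a c"
  then obtain z where z: "z \<in> Q b" "z \<in> convex hull (Q a \<union> Q c)"
    unfolding obstacle_between_def by blast
  show False
    using assms
  proof
    assume "below i b a \<and> below i b c"
    then show False
      using convex_hull_component[OF _ _ z(2), of "{z $ i<..}" i] z(1) by (auto simp: below_def)
  next
    assume "below i a b \<and> below i c b"
    then show False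
      using convex_hull_component[OF _ _ z(2), of "{..<z $ i}" i] z(1) by (auto simp: below_def)
  qed
qed

text \<open>In a coordinate that separates \<open>a\<close> from \<open>b\<close>, the step from
  \<open>b\<close> goes back towards the side of \<open>a\<close>, so both neighbours of
  \<open>b\<close> lie on the same side of it.\<close>

lemma exit_step:
  assumes "a \<noteq> b"
  shows "\<exists>e\<in>unit_steps. \<not> obstacle_between Ob b a (shift e b)"
proof -
  obtain i where "snd a \<noteq> snd b \<or> fst a $ i \<noteq> fst b $ i"
    using assms by (auto simp: prod_eq_iff vec_eq_iff)
  from below_total[OF this] show ?thesis
  proof
    assume "below i a b"
    moreover have "below i (shift (- axis i 1) b) b" by (rule below_component) simp
    ultimately show ?thesis by (meson not_between_below axis_in_unit_steps)
  next
    assume "below i b a"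
    moreover have "below i b (shift (axis i 1) b)" by (rule below_component) simp
    ultimately show ?thesis by (meson not_between_below axis_in_unit_steps)
  qed
qed

text \<open>One direction serves both ends: \<open>a\<close> is reached from the side on which
  \<open>b\<close> lies, and \<open>b\<close> is left towards the side on which \<open>a\<close>
  lies.\<close>

lemma switch_step:
  assumes "snd a \<noteq> snd b" "fst a = fst b"
  shows "\<exists>e\<in>unit_steps. \<not> obstacle_between Ob a (shift (- e) a) b \<and>
                         \<not> obstacle_between Ob b a (shift e b)"
proof -
  \<comment> \<open>Any coordinate will do, since obstacles of different types are separated in all
    of them.\<close>
  fix i :: 'm
  have "below i a b \<or> below i b a" using below_total assms(1) by blast
  then show ?thesis
  proof
    assume "below i a b"
    moreover have "below i a (shift (- (- axis i 1)) a)" "below i (shift (- axis i 1) b) b"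
      by (rule below_component; simp)+
    ultimately show ?thesis by (meson not_between_below axis_in_unit_steps)
  next
    assume "below i b a"
    moreover have "below i (shift (- axis i 1) a) a" "below i b (shift (axis i 1) b)"
      by (rule below_component; simp)+
    ultimately show ?thesis by (meson not_between_below axis_in_unit_steps)
  qed
qed

text \<open>The hull stays in the open cell, so an obstacle meeting it belongs to that cell, and the
  no-eclipse assumption (b) applies.\<close>

lemma visible_cell:
  assumes "snd a \<noteq> snd b" "fst a = fst b"
  shows "visible Ob a b"
proof -
  have False if q: "obstacle_between Ob q a b" for q
  proof -
    obtain z where z: "z \<in> Q q" "z \<in> convex hull (Q a \<union> Q b)" and ne: "q \<noteq> a" "q \<noteq> b"
      using q unfolding obstacle_between_def by blast
    have "fst q $ i = fst a $ i" for i
    proof -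
      have "z $ i \<in> {of_int (fst a $ i)<..<of_int (fst a $ i) + 1}"
      proof (rule convex_hull_component[OF _ _ z(2)])
        fix x assume "x \<in> Q a \<union> Q b"
        then show "x $ i \<in> {of_int (fst a $ i)<..<of_int (fst a $ i) + 1}"
          using obstacle_bounds[of x a i] obstacle_bounds[of x b i] assms(2) by auto
      qed simp
      then show ?thesis using obstacle_bounds[OF z(1), of i] by auto
    qed
    then have fq: "fst q = fst a" by (simp add: vec_eq_iff)
    have "z - int_vec (fst a) \<in> convex hull (B (snd a) \<union> B (snd b))"
    proof -
      have "Q a \<union> Q b = (+) (int_vec (fst a)) ` (B (snd a) \<union> B (snd b))"
        using assms(2) by (simp add: obstacle_translate image_Un)
      then show ?thesis using z(2) by (auto simp: convex_hull_translation)
    qed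
    moreover have "z - int_vec (fst a) \<in> B (snd q)" using z(1) fq by (simp add: mem_obstacle)
    moreover have "snd q \<noteq> snd a" "snd q \<noteq> snd b" using fq ne assms(2) by (auto simp: prod_eq_iff)
    moreover have "convex hull (B (snd a) \<union> B (snd b)) \<inter> B (snd q) = {}"
      if "snd q \<noteq> snd a" "snd q \<noteq> snd b"
      using standing assms(1) that unfolding standing_assumptions_def by metis
    ultimately show False by blast
  qed
  then show ?thesis using assms(1) by (auto simp: visible_def)
qed

text \<open>Sliding along axis \<open>i\<close> keeps the other coordinates, so an obstacle in the
  way agrees with \<open>a\<close> in type and in all other cell numbers. The \<open>i\<close>-th
  coordinate then leaves only the two end obstacles.\<close>

lemma visible_axis: "visible Ob a (shift (axis i 1) a)"
proof -
  have False if q: "obstacle_between Ob q a (shift (axis i 1) a)" for q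
  proof -
    obtain z where z: "z \<in> Q q" "z \<in> convex hull (Q a \<union> Q (shift (axis i 1) a))"
      and ne: "q \<noteq> a" "q \<noteq> shift (axis i 1) a"
      using q unfolding obstacle_between_def by blast
    obtain y t where y: "y \<in> Q a" "0 \<le> t" "t \<le> 1" "z = y + t *\<^sub>R axis i 1"
      using convex_hull_translate_pair[OF convex_obstacle z(2)[unfolded obstacle_shift int_vec_axis]] by blast
    have same: "fst q $ j = fst a $ j \<and> snd q = snd a" if "j \<noteq> i" for j
      using obstacle_same_component[OF z(1) y(1), of j] that by (simp add: y(4) axis_def)
    \<comment> \<open>Dimension at least two supplies a transversal coordinate, which forces the
      type.\<close>
    have "\<not> UNIV \<subseteq> {i}" using dimension card_mono[of "{i}" UNIV] by auto
    then obtain j where "j \<noteq> i" by blast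
    then have sq: "snd q = snd a" using same by blast
    have "z $ i = y $ i + t" by (simp add: y(4) axis_def)
    then have "of_int (fst a $ i) < z $ i" "z $ i < of_int (fst a $ i) + 2"
      using obstacle_bounds[OF y(1), of i] y(2,3) by auto
    then have "fst q $ i = fst a $ i \<or> fst q $ i = fst a $ i + 1"
      using obstacle_bounds[OF z(1), of i] by linarith
    then show False
    proof
      assume "fst q $ i = fst a $ i"
      then have "fst q = fst a" using same by (metis vec_eq_iff)
      then show False using sq ne by (simp add: prod_eq_iff)
    next
      assume "fst q $ i = fst a $ i + 1"
      then have "fst q = axis i 1 + fst a" using same by (auto simp: vec_eq_iff axis_def)
      then show False using sq ne by (simp add: prod_eq_iff)
    qed
  qed
  moreover have "a \<noteq> shift (axis i 1) a" by (auto simp: prod_eq_iff)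
  ultimately show ?thesis by (auto simp: visible_def)
qed

lemma visible_unit_step:
  assumes "e \<in> unit_steps"
  shows "visible Ob a (shift e a)"
proof -
  obtain i where "e = axis i 1 \<or> e = - axis i 1" using assms by (auto simp: unit_steps_def)
  then show ?thesis
  proof
    assume "e = - axis i 1"
    then show ?thesis using visible_axis[of "shift e a" i] by (simp add: visible_commute)
  qed (simp add: visible_axis)
qed

text \<open>A hull point \<open>z\<close> in \<open>Q a\<close> and the shifted point
  \<open>y + int_vec e\<close>, also in \<open>Q a\<close>, differ by \<open>w\<close>, a
  combination of \<open>e\<close> and \<open>f\<close> with weights \<open>1 - t\<close> and
  \<open>- t\<close>. For orthogonal steps its norm is at least \<open>sqrt 2 / 2\<close>, against
  the diameter bound. For \<open>e = - f\<close> both neighbours are the same obstacle, disjoint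
  from \<open>Q a\<close>.\<close>

lemma turn_step:
  assumes e: "e \<in> unit_steps" and f: "f \<in> unit_steps" and "e \<noteq> f"
  shows "\<not> obstacle_between Ob a (shift (- e) a) (shift f a)"
proof
  assume "obstacle_between Ob a (shift (- e) a) (shift f a)"
  then obtain z where z: "z \<in> Q a" "z \<in> convex hull (Q (shift (- e) a) \<union> Q (shift f a))"
    unfolding obstacle_between_def by blast
  let ?a = "shift (- e) a"
  have "shift f a = shift (e + f) ?a" by simp
  then obtain y t where y: "y \<in> Q ?a" "0 \<le> t" "t \<le> 1" "z = y + t *\<^sub>R int_vec (e + f)"
    using convex_hull_translate_pair[OF convex_obstacle, of z ?a "int_vec (e + f)"] z(2)
    by (metis obstacle_shift)
  have ye: "y + int_vec e \<in> Q a" using y(1) by (simp add: mem_obstacle algebra_simps)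
  define w where "w = (1 - t) *\<^sub>R int_vec e - t *\<^sub>R int_vec f"
  have "y + int_vec e - z = w" by (simp add: w_def y(4) algebra_simps)
  then have "norm w < sqrt 2 / 4" using obstacle_diameter[OF ye z(1)] by (simp add: dist_norm)
  then have "norm w ^ 2 < (sqrt 2 / 4) ^ 2" by (intro power_strict_mono) auto
  then have small: "w \<bullet> w < 1 / 8" by (simp add: power2_norm_eq_inner power_divide)
  show False
  proof (cases "e = - f")
    case True
    then have "z \<in> Q ?a" using y by simp
    moreover have "?a \<noteq> a" using unit_steps_nonzero[OF e] by (auto simp: prod_eq_iff)
    ultimately show False using z(1) obstacle_disjoint by blast
  next
    case False
    have ef: "int_vec e \<bullet> int_vec f = 0" by (rule unit_steps_orthogonal[OF e f assms(3) False])
    have "int_vec e \<bullet> int_vec e = 1" "int_vec f \<bullet> int_vec f = 1"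
      using norm_unit_step[OF e] norm_unit_step[OF f] by (simp_all add: norm_eq_sqrt_inner)
    then have "w \<bullet> w = (1 - t)\<^sup>2 + t\<^sup>2"
      using ef by (simp add: w_def inner_diff_left inner_diff_right inner_commute power2_eq_square)
    also have "\<dots> = (2 * t - 1)\<^sup>2 / 2 + 1 / 2" by (simp add: power2_eq_square field_simps)
    also have "\<dots> \<ge> 1 / 2" by simp
    finally show False using small by linarith
  qed
qed

end

section \<open>Connecting admissible sequences\<close>

text \<open>List counterpart of \<open>broken_length\<close>: sequences serve compactness, lists
  serve concatenation.\<close>

fun chain_length :: "'a::metric_space list \<Rightarrow> real" where
  "chain_length (x # y # zs) = dist x y + chain_length (y # zs)"
| "chain_length _ = 0"

lemma chain_length_append:
  "xs \<noteq> [] \<Longrightarrow> ys \<noteq> [] \<Longrightarrow>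
     chain_length (xs @ ys) = chain_length xs + dist (last xs) (hd ys) + chain_length ys"
proof (induction xs rule: chain_length.induct)
  case ("2_2" x)
  then show ?case by (cases ys) auto
qed auto

lemma chain_length_nonneg: "0 \<le> chain_length xs"
  by (induction xs rule: chain_length.induct) auto

lemma chain_length_append_ge: "chain_length xs + chain_length ys \<le> chain_length (xs @ ys)"
  by (cases "xs = [] \<or> ys = []") (auto simp: chain_length_append)

lemma chain_length_map_translate:
  fixes a :: "'a::real_normed_vector"
  shows "chain_length (map ((+) a) xs) = chain_length xs"
  by (induction xs rule: chain_length.induct) auto

lemma chain_length_map_upt:
  "chain_length (map x [0..<Suc p]) = (\<Sum>n<p. dist (x n) (x (Suc n)))"
proof (induction p)
  case (Suc p)
  have "map x [0..<Suc (Suc p)] = map x [0..<Suc p] @ [x (Suc p)]" by simp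
  also have "chain_length \<dots> = chain_length (map x [0..<Suc p]) + dist (x p) (x (Suc p))"
    by (subst chain_length_append) (simp_all add: last_map)
  finally show ?case using Suc by simp
qed simp

text \<open>For integer vectors the bound means that the cells are equal or differ by a unit
  step.\<close>

definition nearby :: "(int ^ 'm) \<times> 'n \<Rightarrow> (int ^ 'm::finite) \<times> 'n \<Rightarrow> bool" where
  "nearby a b \<longleftrightarrow> norm (int_vec (fst b - fst a)) \<le> 1"

lemma nearby_displacement:
  "successively nearby (a # ws @ [b]) \<Longrightarrow> norm (int_vec (fst b - fst a)) \<le> length ws + 1"
proof (induction ws arbitrary: a)
  case (Cons w ws)
  have "norm (int_vec (fst b - fst w)) \<le> length ws + 1" using Cons by simp
  moreover have "norm (int_vec (fst w - fst a)) \<le> 1" using Cons.prems by (simp add: nearby_def)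
  moreover have "int_vec (fst b - fst a) = int_vec (fst b - fst w) + int_vec (fst w - fst a)" by simp
  ultimately show ?case
    using norm_triangle_ineq[of "int_vec (fst b - fst w)" "int_vec (fst w - fst a)"]
    by (simp del: int_vec_simps)
qed (simp add: nearby_def)

lemma admissible_list_last_visible: "admissible_list Ob (us @ [a, b]) \<Longrightarrow> visible Ob a b"
proof (induction us)
  case (Cons u us)
  then show ?case by (cases us; cases "tl us") auto
qed simp

lemma admissible_list_extend:
  assumes "admissible_list Ob (us @ [a, b])" "admissible_list Ob (b # ys)"
    and "\<And>c zs. ys = c # zs \<Longrightarrow> \<not> obstacle_between Ob b a c"
  shows "admissible_list Ob (us @ a # b # ys)"
proof (rule admissible_list_append[OF assms(1)])
  show "admissible_list Ob (a # b # ys)"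
    using assms admissible_list_last_visible[OF assms(1)] by (cases ys) auto
qed

context obstacle_family
begin

text \<open>An admissible continuation of \<open>a, b\<close> by \<open>n\<close> obstacles with last two entries \<open>c, d\<close>,
  in which consecutive entries from \<open>b\<close> on lie in equal or adjacent cells.\<close>

definition connects :: "nat \<Rightarrow> (int ^ 'm) \<times> 'n \<Rightarrow> (int ^ 'm) \<times> 'n \<Rightarrow>
    (int ^ 'm) \<times> 'n \<Rightarrow> (int ^ 'm) \<times> 'n \<Rightarrow> bool" where
  "connects n a b c d \<longleftrightarrow> (\<exists>xs us. length xs = n \<and> a # b # xs = us @ [c, d] \<and>
      admissible_list Ob (a # b # xs) \<and> successively nearby (b # xs))"

lemma connects_refl: "visible Ob a b \<Longrightarrow> connects 0 a b a b"
  unfolding connects_def by (intro exI[of _ "[]"]) auto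

lemma connects_step:
  assumes "connects n a b c d" "visible Ob d e" "\<not> obstacle_between Ob d c e" "nearby d e"
  shows "connects (Suc n) a b d e"
proof -
  obtain xs us where xs: "length xs = n" "a # b # xs = us @ [c, d]"
    "admissible_list Ob (a # b # xs)" "successively nearby (b # xs)"
    using assms(1) unfolding connects_def by blast
  have "last (b # xs) = d" using arg_cong[OF xs(2), of last] by simp
  then have succ: "successively nearby (b # (xs @ [e]))"
    using xs(4) assms(4) successively_append_iff[of nearby "b # xs" "[e]"] by simp
  have "a # b # (xs @ [e]) = us @ c # d # [e]" using xs(2) by simp
  moreover have "admissible_list Ob (us @ c # d # [e])"
    by (rule admissible_list_extend) (use xs(2,3) assms(2,3) in auto)
  ultimately have adm: "admissible_list Ob (a # b # (xs @ [e]))" by (simp only:)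
  have "a # b # (xs @ [e]) = (us @ [c]) @ [d, e]" using xs(2) by simp
  then show ?thesis
    unfolding connects_def using succ adm xs(1) by (metis length_append_singleton)
qed

lemma nearby_unit_step: "e \<in> unit_steps \<Longrightarrow> nearby a (shift e a)"
  by (simp add: nearby_def norm_unit_step)

lemma connects_unit_step:
  assumes "connects n a b c d" "e \<in> unit_steps" "\<not> obstacle_between Ob d c (shift e d)"
  shows "connects (Suc n) a b d (shift e d)"
  using assms by (intro connects_step visible_unit_step nearby_unit_step)

text \<open>A step different from the last one is always a permitted turn. If the last step already
  is \<open>f\<close>, it is reversed and \<open>f\<close> is taken again; so at least one obstacle
  is added in either case, which guarantees a nonempty connection later.\<close>

lemma connects_turn:
  assumes con: "connects n a b (shift (- e) d) d" and e: "e \<in> unit_steps" and f: "f \<in> unit_steps"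
  shows "\<exists>n'\<le>n + 2. \<exists>d'. snd d' = snd d \<and> 1 \<le> n' \<and> connects n' a b (shift (- f) d') d'"
proof -
  have step: "connects (Suc k) a b (shift (- f') (shift f' c)) (shift f' c)"
    if "connects k a b (shift (- e') c) c" "e' \<in> unit_steps" "f' \<in> unit_steps" "e' \<noteq> f'" for k c e' f'
    using connects_unit_step[OF that(1,3) turn_step[OF that(2-4)]] by simp
  show ?thesis
  proof (cases "e = f")
    case False
    then show ?thesis using step[OF con e f] by (intro exI[of _ "Suc n"] conjI exI[of _ "shift f d"]) auto
  next
    case True
    have "e \<noteq> - e"
      using unit_steps_nonzero[OF e] by (auto simp: vec_eq_iff)
    then show ?thesis
      using step[OF step[OF con e], of "- e" f] e f True
      by (intro exI[of _ "Suc (Suc n)"] conjI exI[of _ "shift f (shift (- e) d)"]) auto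
  qed
qed

text \<open>The direction must not depend on the cell: it is fixed before the turn that prepares the
  switch, and that turn moves to another cell.\<close>

lemma switch_step_everywhere:
  assumes "r \<noteq> s"
  shows "\<exists>e\<in>unit_steps. \<forall>k. \<not> obstacle_between Ob (k, r) (shift (- e) (k, r)) (k, s) \<and>
                             \<not> obstacle_between Ob (k, s) (k, r) (shift e (k, s))"
proof -
  obtain e where e: "e \<in> unit_steps"
    "\<not> obstacle_between Ob (0, r) (shift (- e) (0, r)) (0, s)"
    "\<not> obstacle_between Ob (0, s) (0, r) (shift e (0, s))"
    using switch_step[of "(0, r)" "(0, s)"] assms by auto
  have "(k, q) = shift k (0, q)" "shift f (k, q) = shift k (shift f (0, q))" for k f and q :: 'n
    by (simp_all add: shift_def)
  then show ?thesis using e by (metis obstacle_between_shift)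
qed

text \<open>At most two obstacles to make the last step \<open>f\<close>, one for the switch inside
  the cell, and one for leaving by \<open>f\<close>, which restores the form ending in a unit
  step.\<close>

lemma connects_switch:
  assumes con: "connects n a b (shift (- e) d) d" and e: "e \<in> unit_steps"
  shows "\<exists>n'\<le>n + 4. \<exists>d' f. snd d' = s \<and> f \<in> unit_steps \<and> connects n' a b (shift (- f) d') d'"
proof (cases "snd d = s")
  case True
  then show ?thesis using con e by (intro exI[of _ n] conjI exI[of _ d] exI[of _ e]) auto
next
  case False
  then obtain f where f: "f \<in> unit_steps"
    "\<And>k. \<not> obstacle_between Ob (k, snd d) (shift (- f) (k, snd d)) (k, s)"
    "\<And>k. \<not> obstacle_between Ob (k, s) (k, snd d) (shift f (k, s))"
    using switch_step_everywhere by meson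
  obtain n' d' where d': "n' \<le> n + 2" "snd d' = snd d" "connects n' a b (shift (- f) d') d'"
    using connects_turn[OF con e f(1)] by blast
  have d'_eq: "d' = (fst d', snd d)" using d'(2) by (simp add: prod_eq_iff)
  have "connects (Suc n') a b d' (fst d', s)"
  proof (rule connects_step[OF d'(3)])
    show "visible Ob d' (fst d', s)" using d'(2) False by (intro visible_cell) auto
    show "\<not> obstacle_between Ob d' (shift (- f) d') (fst d', s)" using f(2) d'_eq by metis
  qed (simp add: nearby_def)
  then have "connects (Suc (Suc n')) a b (fst d', s) (shift f (fst d', s))"
    using f(1) f(3)[of "fst d'"] d'_eq by (intro connects_unit_step) auto
  then show ?thesis
    using d'(1) f(1)
    by (intro exI[of _ "Suc (Suc n')"] conjI exI[of _ "shift f (fst d', s)"] exI[of _ f]) auto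
qed

text \<open>The bound 7 is 1 for the exit from \<open>b\<close>, 4 for reaching the type of
  \<open>c\<close>, and 2 for turning into the direction required to continue with
  \<open>d\<close>.\<close>

lemma connection_exists:
  assumes ab: "visible Ob a b" and cd: "visible Ob c d"
  shows "\<exists>n k g. 1 \<le> n \<and> n \<le> 7 \<and> connects n a b g (shift k c) \<and>
           \<not> obstacle_between Ob (shift k c) g (shift k d)"
proof -
  obtain e where e: "e \<in> unit_steps" "\<not> obstacle_between Ob b a (shift e b)"
    using exit_step[of a b] ab by (auto simp: visible_def)
  have "connects 1 a b b (shift e b)"
    using connects_unit_step[OF connects_refl[OF ab] e] by simp
  then have "connects 1 a b (shift (- e) (shift e b)) (shift e b)" by simp
  then obtain n1 d1 f where d1: "n1 \<le> 5" "snd d1 = snd c" "f \<in> unit_steps"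
    "connects n1 a b (shift (- f) d1) d1"
    using connects_switch[OF _ e(1), of 1 a b "shift e b" "snd c"] by auto
  \<comment> \<open>Leaving is used backwards in time: \<open>c\<close> may be followed by
    \<open>d\<close> if it is entered from \<open>shift h c\<close>, that is, by the step
    \<open>- h\<close>.\<close>
  obtain h where h: "h \<in> unit_steps" "\<not> obstacle_between Ob c d (shift h c)"
    using exit_step[of d c] cd by (auto simp: visible_def)
  obtain n2 d2 where d2: "n2 \<le> n1 + 2" "1 \<le> n2" "snd d2 = snd d1" "connects n2 a b (shift h d2) d2"
    using connects_turn[OF d1(4,3), of "- h"] h(1) by auto
  define k where "k = fst d2 - fst c"
  have k: "d2 = shift k c" using d2(3) d1(2) by (simp add: k_def prod_eq_iff)
  have "shift h d2 = shift k (shift h c)" by (simp add: k algebra_simps)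
  then have "\<not> obstacle_between Ob d2 (shift h d2) (shift k d)"
    using h(2) by (simp only: k obstacle_between_shift obstacle_between_commute[of Ob c d] not_False_eq_True)
  moreover have "n2 \<le> 7" using d1(1) d2(1) by simp
  ultimately show ?thesis using d2(2,4) k by blast
qed

lemma connect_lists:
  assumes A: "admissible_list Ob A" "2 \<le> length A" and C: "admissible_list Ob C" "2 \<le> length C"
  shows "\<exists>ws k. length ws \<le> 6 \<and> admissible_list Ob (A @ ws @ map (shift k) C) \<and>
           successively nearby (last A # ws @ [shift k (hd C)])"
proof -
  obtain us0 a b where A_eq: "A = us0 @ [a, b]"
    using A(2) by (cases A rule: rev_cases; cases "butlast A" rule: rev_cases) auto
  obtain c d ys where C_eq: "C = c # d # ys"
    using C(2) by (cases C; cases "tl C") auto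
  have vis: "visible Ob a b" "visible Ob c d"
    using A(1) admissible_list_last_visible A_eq C(1) C_eq by (blast, cases ys, auto)
  obtain n k g where n: "1 \<le> n" "n \<le> 7" "connects n a b g (shift k c)"
    "\<not> obstacle_between Ob (shift k c) g (shift k d)"
    using connection_exists[OF vis] by blast
  then obtain xs us where xs: "length xs = n" "a # b # xs = us @ [g, shift k c]"
      "admissible_list Ob (a # b # xs)" "successively nearby (b # xs)"
    unfolding connects_def by blast
  have "xs \<noteq> []" using xs(1) n(1) by auto
  then have "last xs = shift k c" using arg_cong[OF xs(2), of last] by simp
  then obtain ws where ws: "xs = ws @ [shift k c]" using \<open>xs \<noteq> []\<close> by (metis append_butlast_last_id)
  have "admissible_list Ob (us @ g # shift k c # map (shift k) (d # ys))"
  proof (rule admissible_list_extend)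
    show "admissible_list Ob (us @ [g, shift k c])" using xs(2,3) by simp
    show "admissible_list Ob (shift k c # map (shift k) (d # ys))"
      using C(1) C_eq admissible_list_map_shift[of Ob k C] by simp
  qed (use n(4) in auto)
  moreover have "us @ g # shift k c # map (shift k) (d # ys) = a # b # ws @ map (shift k) C"
    using xs(2) ws C_eq by (metis append_Cons append_Nil append_assoc list.simps(9))
  ultimately have "admissible_list Ob (us0 @ a # b # ws @ map (shift k) C)"
    using A(1) A_eq by (simp add: admissible_list_append)
  then have "admissible_list Ob (A @ ws @ map (shift k) C)" using A_eq by simp
  moreover have "successively nearby (last A # ws @ [shift k (hd C)])"
    using xs(4) ws A_eq C_eq by simp
  ultimately show ?thesis using xs(1) ws n(2) by (intro exI[of _ ws] exI[of _ k]) auto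
qed

section \<open>Minimal length of a list of obstacles\<close>

definition threads :: "(real ^ 'm) list \<Rightarrow> ((int ^ 'm) \<times> 'n) list \<Rightarrow> bool" where
  "threads ps qs \<longleftrightarrow> list_all2 (\<lambda>x q. x \<in> Q q) ps qs"

definition min_length :: "((int ^ 'm) \<times> 'n) list \<Rightarrow> real" where
  "min_length qs = (INF ps\<in>{ps. threads ps qs}. chain_length ps)"

lemma threads_exists: "\<exists>ps. threads ps qs"
proof -
  have "threads (map (\<lambda>q. SOME x. x \<in> Q q) qs) qs"
    using obstacle_nonempty unfolding threads_def
    by (simp add: list_all2_map1 list_all2_same some_in_eq)
  then show ?thesis ..
qed

lemma min_length_le: "threads ps qs \<Longrightarrow> min_length qs \<le> chain_length ps"
  unfolding min_length_def by (intro cINF_lower bdd_belowI2[of _ 0] chain_length_nonneg) auto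

lemma min_length_ge: "(\<And>ps. threads ps qs \<Longrightarrow> c \<le> chain_length ps) \<Longrightarrow> c \<le> min_length qs"
  unfolding min_length_def using threads_exists by (intro cINF_greatest) auto

lemma threads_append:
  "threads ps qs \<Longrightarrow> threads ps' qs' \<Longrightarrow> threads (ps @ ps') (qs @ qs')"
  unfolding threads_def by (rule list_all2_appendI)

text \<open>Cutting a chain in two only drops the link at the cut.\<close>

lemma min_length_append: "min_length qs + min_length rs \<le> min_length (qs @ rs)"
proof (rule min_length_ge)
  fix ps assume "threads ps (qs @ rs)"
  then obtain p1 p2 where p: "ps = p1 @ p2" "threads p1 qs" "threads p2 rs"
    unfolding threads_def list_all2_append2 by blast
  have "min_length qs + min_length rs \<le> chain_length p1 + chain_length p2"
    by (intro add_mono min_length_le p)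
  also have "\<dots> \<le> chain_length ps" unfolding p(1) by (rule chain_length_append_ge)
  finally show "min_length qs + min_length rs \<le> chain_length ps" .
qed

lemma min_length_nonneg: "0 \<le> min_length qs"
  by (rule min_length_ge) (rule chain_length_nonneg)

lemma min_length_shift [simp]: "min_length (map (shift k) qs) = min_length qs"
proof -
  have le: "min_length (map (shift k) qs) \<le> min_length qs" for k qs
  proof (rule min_length_ge)
    fix ps assume "threads ps qs"
    then have "threads (map ((+) (int_vec k)) ps) (map (shift k) qs)"
      by (auto simp: threads_def list_all2_map1 list_all2_map2 obstacle_shift elim!: list_all2_mono)
    from min_length_le[OF this] show "min_length (map (shift k) qs) \<le> chain_length ps"
      by (simp add: chain_length_map_translate)
  qed
  have "map (shift (- k)) (map (shift k) qs) = qs" by (simp add: map_idI)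
  then show ?thesis using le[of k qs] le[of "- k" "map (shift k) qs"] by simp
qed

text \<open>The crude \<open>CARD('m)\<close> is the l1 diameter of the unit cube; only its
  independence of the obstacles matters below.\<close>

lemma base_distance:
  assumes "x \<in> B r" "y \<in> B s"
  shows "norm (x - y) \<le> CARD('m)"
proof -
  have "norm (x - y) \<le> (\<Sum>i\<in>UNIV. \<bar>(x - y) $ i\<bar>)" by (rule norm_le_l1_cart)
  also have "\<dots> \<le> (\<Sum>i\<in>(UNIV::'m set). 1)"
  proof (intro sum_mono)
    fix i
    show "\<bar>(x - y) $ i\<bar> \<le> 1"
      using base_bounds[OF assms(1), of i] base_bounds[OF assms(2), of i] by simp
  qed
  finally show ?thesis by simp
qed

lemma displacement_approx:
  assumes "x \<in> Q a" "y \<in> Q b"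
  shows "norm ((y - x) - int_vec (fst b - fst a)) \<le> CARD('m)"
  using base_distance[of "y - int_vec (fst b)" "snd b" "x - int_vec (fst a)" "snd a"] assms
  by (simp add: mem_obstacle algebra_simps)

lemma nearby_distance:
  assumes "x \<in> Q a" "y \<in> Q b" "nearby a b"
  shows "dist x y \<le> CARD('m) + 1"
proof -
  have "dist x y = norm (((y - x) - int_vec (fst b - fst a)) + int_vec (fst b - fst a))"
    by (simp add: dist_norm norm_minus_commute)
  also have "\<dots> \<le> CARD('m) + 1"
    using displacement_approx[OF assms(1,2)] assms(3) unfolding nearby_def
    by (intro norm_triangle_le) simp
  finally show ?thesis .
qed

text \<open>The inserted points are arbitrary. Each of the \<open>length ws + 1\<close> new links
  costs at most \<open>CARD('m)\<close> for the positions inside the cells and 1 for the change of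
  cell.\<close>

lemma connecting_chain:
  assumes "threads p A" "A \<noteq> []" "threads p' C" "C \<noteq> []" "successively nearby (last A # ws @ [hd C])"
  shows "\<exists>ps. threads ps ws \<and> chain_length (p @ ps @ p')
           \<le> chain_length p + chain_length p' + (length ws + 1) * (CARD('m) + 1)"
  using assms
proof (induction ws arbitrary: A p)
  case Nil
  have ne: "p \<noteq> []" "p' \<noteq> []" using Nil by (auto simp: threads_def)
  have "last p \<in> Q (last A)" "hd p' \<in> Q (hd C)"
    using Nil ne unfolding threads_def list_all2_conv_all_nth
    by (auto simp: last_conv_nth hd_conv_nth)
  then have "dist (last p) (hd p') \<le> CARD('m) + 1" using Nil by (intro nearby_distance) auto
  then show ?case using ne by (intro exI[of _ "[]"]) (simp add: chain_length_append threads_def)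
next
  case (Cons w ws)
  have ne: "p \<noteq> []" using Cons by (auto simp: threads_def)
  obtain x where x: "x \<in> Q w" using obstacle_nonempty by blast
  have "last p \<in> Q (last A)"
    using Cons.prems ne unfolding threads_def list_all2_conv_all_nth by (auto simp: last_conv_nth)
  then have d: "dist (last p) x \<le> CARD('m) + 1" using Cons.prems x by (intro nearby_distance) auto
  have "threads (p @ [x]) (A @ [w])" using Cons.prems(1) x by (intro threads_append) (auto simp: threads_def)
  then obtain ps where ps: "threads ps ws" "chain_length ((p @ [x]) @ ps @ p')
      \<le> chain_length (p @ [x]) + chain_length p' + (length ws + 1) * (CARD('m) + 1)"
    using Cons.IH[of "p @ [x]" "A @ [w]"] Cons.prems by auto
  have "threads (x # ps) (w # ws)" using ps(1) x by (simp add: threads_def)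
  moreover have "chain_length (p @ (x # ps) @ p')
      \<le> chain_length p + chain_length p' + (length (w # ws) + 1) * (CARD('m) + 1)"
    using ps(2) d ne by (simp add: chain_length_append algebra_simps)
  ultimately show ?case by blast
qed

lemma min_length_connect:
  assumes "A \<noteq> []" "C \<noteq> []" "successively nearby (last A # ws @ [hd C])"
  shows "min_length (A @ ws @ C) \<le> min_length A + min_length C + (length ws + 1) * (CARD('m) + 1)"
proof -
  let ?c = "(length ws + 1) * (CARD('m) + 1)"
  have le: "min_length (A @ ws @ C) \<le> chain_length p + chain_length p' + ?c"
    if p: "threads p A" and p': "threads p' C" for p p'
  proof -
    obtain ps where "threads ps ws" "chain_length (p @ ps @ p') \<le> chain_length p + chain_length p' + ?c"
      using connecting_chain[OF p assms(1) p' assms(2,3)] by blast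
    moreover from this have "min_length (A @ ws @ C) \<le> chain_length (p @ ps @ p')"
      using p p' by (intro min_length_le threads_append)
    ultimately show ?thesis by linarith
  qed
  \<comment> \<open>The infimum is taken over the second chain with the first one fixed, and only
    afterwards over the first.\<close>
  have "min_length (A @ ws @ C) - ?c - chain_length p \<le> min_length C" if "threads p A" for p
    using le[OF that] by (intro min_length_ge) (simp add: algebra_simps)
  then have "min_length (A @ ws @ C) - ?c - min_length C \<le> min_length A"
    by (intro min_length_ge) (simp add: algebra_simps)
  then show ?thesis by simp
qed

end

section \<open>Trajectories\<close>

lemma C2_boundary_translate:
  fixes K :: "(real ^ 'm) set"
  assumes "C2_boundary K"
  shows "C2_boundary ((+) a ` K)"
  unfolding C2_boundary_def
proof
  fix x assume "x \<in> frontier ((+) a ` K)"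
  then have x: "x - a \<in> frontier K" by (auto simp: frontier_translation)
  obtain U f g H where U: "open U" "x - a \<in> U"
      and f: "\<forall>y\<in>U. (f has_derivative (\<lambda>h. g y \<bullet> h)) (at y)"
      and g: "\<forall>y\<in>U. (g has_derivative (\<lambda>h. H y *v h)) (at y)"
      and H: "continuous_on U H" "g (x - a) \<noteq> 0"
      and front: "frontier K \<inter> U = {y \<in> U. f y = (0::real)}"
    using bspec[OF assms[unfolded C2_boundary_def] x] by (elim exE conjE) (rule that; assumption)
  let ?U = "(\<lambda>y. y - a) -` U"
  have der: "((\<lambda>y. F (y - a)) has_derivative F') (at y)"
    if "(F has_derivative F') (at (y - a))" for y F' and F :: "real ^ 'm \<Rightarrow> 'b::real_normed_vector"
  proof -
    have "((\<lambda>y. y - a) has_derivative (\<lambda>h. h)) (at y)" by (auto intro!: derivative_eq_intros)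
    from has_derivative_compose[OF this that] show ?thesis .
  qed
  show "\<exists>U f g H. open U \<and> x \<in> U \<and>
      (\<forall>y\<in>U. (f has_derivative (\<lambda>h. g y \<bullet> h)) (at y)) \<and>
      (\<forall>y\<in>U. (g has_derivative (\<lambda>h. H y *v h)) (at y)) \<and>
      continuous_on U H \<and> g x \<noteq> 0 \<and> frontier ((+) a ` K) \<inter> U = {y \<in> U. f y = (0::real)}"
  proof (intro exI conjI)
    show "open ?U" by (intro open_vimage U continuous_intros)
    show "\<forall>y\<in>?U. ((\<lambda>y. f (y - a)) has_derivative (\<lambda>h. g (y - a) \<bullet> h)) (at y)"
      using f by (auto intro: der)
    show "\<forall>y\<in>?U. ((\<lambda>y. g (y - a)) has_derivative (\<lambda>h. H (y - a) *v h)) (at y)"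
      using g by (auto intro: der)
    show "continuous_on ?U (\<lambda>y. H (y - a))"
      by (rule continuous_on_compose2[OF H(1)]) (auto intro!: continuous_intros)
    have "y \<in> (+) a ` frontier K \<longleftrightarrow> y - a \<in> frontier K" for y
      by (auto intro: image_eqI[of _ _ "y - a"])
    then show "frontier ((+) a ` K) \<inter> ?U = {y \<in> ?U. f (y - a) = 0}"
      using front by (auto simp: frontier_translation)
  qed (use U H in auto)
qed

context obstacle_family
begin

lemma C2_boundary_obstacle: "C2_boundary (Q q)"
  unfolding obstacle_translate using standing
  by (intro C2_boundary_translate) (simp add: standing_assumptions_def)

lemma billiard_table_interior: "z \<in> billiard_table Ob \<Longrightarrow> z \<notin> interior (Q q)"
  unfolding billiard_table_def closure_complement using interior_mono[of "Q q" "\<Union>q. Q q"] by blast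

lemma not_obstacle_billiard_table: "(\<And>q. z \<notin> Q q) \<Longrightarrow> z \<in> billiard_table Ob"
  unfolding billiard_table_def by (rule subsetD[OF closure_subset]) blast

text \<open>The definition of \<^const>\<open>reflects\<close> also admits reflections from the inside; they are
  excluded because the incoming piece stays in the table.\<close>

lemma trajectory_piece_incoming:
  assumes x: "x \<in> frontier (Q q)" and u: "outer_unit_normal (Q q) x u" and l: "0 < l"
    and path: "\<And>s. s \<in> {0..l} \<Longrightarrow> x - s *\<^sub>R v \<in> billiard_table Ob"
  shows "v \<bullet> u \<le> 0"
proof (rule ccontr)
  assume "\<not> ?thesis"
  then have "(- v) \<bullet> u < 0" by simp
  then obtain s where "s \<in> {0..l}" "x + s *\<^sub>R (- v) \<in> interior (Q q)"
    using inward_meets_interior[OF convex_obstacle compact_imp_closed[OF compact_obstacle]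
        interior_obstacle C2_boundary_obstacle u _ l] by blast
  then show False using path billiard_table_interior by auto
qed

text \<open>The reflection points form a competing chain, which gives the lower bound. The upper
  bound compares with an arbitrary chain by \<open>sum_dist_broken_path\<close>; the additive 2 pays
  for the different end points, each displaced by at most 1 inside its obstacle.\<close>

lemma trajectory_piece_length:
  assumes "trajectory_piece Ob \<gamma> L p \<sigma>"
  shows "min_length (map \<sigma> [0..<Suc p]) \<le> L" "L \<le> min_length (map \<sigma> [0..<Suc p]) + 2"
    "0 < p \<longleftrightarrow> 0 < L" "\<gamma> 0 \<in> Q (\<sigma> 0)" "\<gamma> L \<in> Q (\<sigma> p)"
proof -
  obtain \<tau> v where \<tau>: "\<tau> 0 = 0" "\<tau> p = L"
    and pieces: "\<forall>n<p. \<tau> n < \<tau> (Suc n) \<and> norm (v n) = 1 \<and> (\<forall>t\<in>{\<tau> n..\<tau> (Suc n)}.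
      \<gamma> t = \<gamma> (\<tau> n) + (t - \<tau> n) *\<^sub>R v n \<and> \<gamma> t \<in> billiard_table Ob)"
    and front: "\<forall>n\<le>p. \<gamma> (\<tau> n) \<in> frontier (Q (\<sigma> n))"
    and refl: "\<forall>n. Suc n < p \<longrightarrow> reflects (Q (\<sigma> (Suc n))) (\<gamma> (\<tau> (Suc n))) (v n) (v (Suc n))"
    using assms unfolding trajectory_piece_def by (elim exE conjE) (rule that; assumption)
  have mono: "\<tau> n < \<tau> (Suc n)" and v: "norm (v n) = 1" if "n < p" for n
    using pieces that by blast+
  have path: "\<gamma> t = \<gamma> (\<tau> n) + (t - \<tau> n) *\<^sub>R v n" and table: "\<gamma> t \<in> billiard_table Ob"
    if "n < p" "t \<in> {\<tau> n..\<tau> (Suc n)}" for n t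
    using pieces that by blast+
  define x where "x n = \<gamma> (\<tau> n)" for n
  define l where "l n = \<tau> (Suc n) - \<tau> n" for n
  have step: "x (Suc n) = x n + l n *\<^sub>R v n" if "n < p" for n
    using path[OF that, of "\<tau> (Suc n)"] mono[OF that] by (simp add: x_def l_def)
  have lpos: "0 < l n" if "n < p" for n using mono[OF that] by (simp add: l_def)
  have sum_l: "(\<Sum>n<p. l n) = L"
    unfolding l_def using sum_lessThan_telescope[of \<tau> p] \<tau> by simp
  have inQ: "x n \<in> Q (\<sigma> n)" if "n \<le> p" for n
    unfolding x_def using front that frontier_subset_closed[OF compact_imp_closed[OF compact_obstacle]]
    by (meson subsetD)
  show "\<gamma> 0 \<in> Q (\<sigma> 0)" "\<gamma> L \<in> Q (\<sigma> p)" using inQ[of 0] inQ[of p] \<tau> by (auto simp: x_def)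
  show "0 < p \<longleftrightarrow> 0 < L"
    using sum_l lpos sum_pos[of "{..<p}" l] by (cases "p = 0") auto
  have threads_x: "threads (map y [0..<Suc p]) (map \<sigma> [0..<Suc p])"
    if "\<And>n. n \<le> p \<Longrightarrow> y n \<in> Q (\<sigma> n)" for y
    unfolding threads_def list_all2_map1 list_all2_map2
    using that by (intro list_all2_refl[THEN list_all2_mono] list_all2_all_nthI) (auto simp: nth_append simp del: upt_Suc)
  have "min_length (map \<sigma> [0..<Suc p]) \<le> chain_length (map x [0..<Suc p])"
    by (intro min_length_le threads_x inQ)
  also have "\<dots> = (\<Sum>n<p. l n)"
    unfolding chain_length_map_upt using step v lpos
    by (intro sum.cong) (auto simp: dist_norm less_imp_le)
  finally show "min_length (map \<sigma> [0..<Suc p]) \<le> L" using sum_l by simp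
  have "L - 2 \<le> min_length (map \<sigma> [0..<Suc p])"
  proof (rule min_length_ge)
    fix ps assume ps: "threads ps (map \<sigma> [0..<Suc p])"
    then have len: "length ps = Suc p" by (auto simp: threads_def dest: list_all2_lengthD)
    define y where "y n = ps ! n" for n
    have ps_eq: "ps = map y [0..<Suc p]" unfolding y_def using len map_nth[of ps] by simp
    have yQ: "y n \<in> Q (\<sigma> n)" if "n \<le> p" for n
      using list_all2_nthD2[OF ps[unfolded threads_def], of n] that
      by (simp add: y_def nth_append del: upt_Suc)
    \<comment> \<open>By the reflection law, \<open>v n - v (Suc n)\<close> is
      \<open>2 * (v n \<bullet> u)\<close> times \<open>u\<close>. Both factors of the resulting
      product are nonpositive: the incoming velocity does not point outwards, and the obstacle lies
      behind its supporting hyperplane.\<close>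
    have turn: "0 \<le> (v n - v (Suc n)) \<bullet> (y (Suc n) - x (Suc n))" if n: "Suc n < p" for n
    proof -
      obtain u where u: "outer_unit_normal (Q (\<sigma> (Suc n))) (x (Suc n)) u"
        "v (Suc n) = v n - (2 * (v n \<bullet> u)) *\<^sub>R u"
        using refl n unfolding reflects_def x_def by blast
      have "v n \<bullet> u \<le> 0"
      proof (rule trajectory_piece_incoming[OF _ u(1)])
        show "x (Suc n) \<in> frontier (Q (\<sigma> (Suc n)))" using front n by (simp add: x_def)
        show "0 < l n" using lpos n by simp
        fix s assume s: "s \<in> {0..l n}"
        then have t: "\<tau> (Suc n) - s \<in> {\<tau> n..\<tau> (Suc n)}" by (auto simp: l_def)
        have "x (Suc n) - s *\<^sub>R v n = \<gamma> (\<tau> (Suc n) - s)"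
        proof -
          have "\<tau> (Suc n) - s - \<tau> n = l n - s" by (simp add: l_def)
          then have "\<gamma> (\<tau> (Suc n) - s) = x n + (l n - s) *\<^sub>R v n"
            using path[OF _ t] n by (simp add: x_def)
          then show ?thesis using step[of n] n by (simp add: algebra_simps)
        qed
        then show "x (Suc n) - s *\<^sub>R v n \<in> billiard_table Ob" using table[OF _ t] n by simp
      qed
      moreover have "(y (Suc n) - x (Suc n)) \<bullet> u \<le> 0"
        using u(1) yQ[of "Suc n"] n by (simp add: outer_unit_normal_def)
      ultimately have "0 \<le> (v n \<bullet> u) * ((y (Suc n) - x (Suc n)) \<bullet> u)"
        by (rule mult_nonpos_nonpos)
      then show ?thesis by (simp add: u(2) inner_commute)
    qed
    have close: "dist (x n) (y n) \<le> 1" if "n \<le> p" for n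
    proof -
      have "dist (x n) (y n) < sqrt 2 / 4" by (rule obstacle_diameter[OF inQ[OF that] yQ[OF that]])
      moreover have "sqrt 2 / 4 \<le> 1" using real_sqrt_le_iff[of 2 4] by simp
      ultimately show ?thesis by simp
    qed
    have "(\<Sum>n<p. l n) \<le> (\<Sum>n<p. dist (y n) (y (Suc n))) + dist (x 0) (y 0) + dist (x p) (y p)"
      using step v turn by (rule sum_dist_broken_path)
    then show "L - 2 \<le> chain_length ps"
      using close[of 0] close[of p] unfolding ps_eq chain_length_map_upt sum_l by simp
  qed
  then show "L \<le> min_length (map \<sigma> [0..<Suc p]) + 2" by simp
qed

text \<open>On the open segment the half-spaces of \<open>u\<close> and \<open>w\<close> exclude the
  two end obstacles and visibility excludes all others; the end points follow because the table is
  closed.\<close>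

lemma segment_billiard_table:
  assumes vis: "visible Ob a b" and x: "x \<in> Q a" "y \<in> Q b"
    and u: "\<And>z. z \<in> Q a \<Longrightarrow> (z - x) \<bullet> u \<le> 0" "(y - x) \<bullet> u > 0"
    and w: "\<And>z. z \<in> Q b \<Longrightarrow> (z - y) \<bullet> w \<le> 0" "(y - x) \<bullet> w < 0"
  shows "closed_segment x y \<subseteq> billiard_table Ob"
proof -
  have "z \<in> billiard_table Ob" if z: "z \<in> open_segment x y" for z
  proof (rule not_obstacle_billiard_table)
    obtain r where r: "0 < r" "r < 1" "z = (1 - r) *\<^sub>R x + r *\<^sub>R y" using z by (auto simp: in_segment)
    have zx: "z - x = r *\<^sub>R (y - x)" "z - y = - ((1 - r) *\<^sub>R (y - x))"
      by (simp_all add: r(3) algebra_simps)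
    have "z \<in> convex hull {x, y}"
      using z segment_open_subset_closed[of x y] unfolding segment_convex_hull[of x y] by blast
    then have hull: "z \<in> convex hull (Q a \<union> Q b)"
      using x hull_mono[of "{x, y}" "Q a \<union> Q b" convex] by blast
    fix q
    show "z \<notin> Q q"
    proof
      assume zq: "z \<in> Q q"
      consider "q = a" | "q = b" | "q \<noteq> a" "q \<noteq> b" by blast
      then show False
      proof cases
        case 1
        then show False using u(1)[of z] u(2) zq r(1) zx(1) by (simp add: mult_le_0_iff)
      next
        case 2
        then show False using w(1)[of z] w(2) zq r(2) by (simp add: zx(2) mult_le_0_iff zero_le_mult_iff)
      next
        case 3
        then have "obstacle_between Ob q a b" using zq hull by (auto simp: obstacle_between_def)
        then show False using vis unfolding visible_def by blast
      qed
    qed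
  qed
  then have "closure (open_segment x y) \<subseteq> billiard_table Ob"
    by (intro closure_minimal) (auto simp: billiard_table_def)
  moreover have "x \<noteq> y" using u(2) by auto
  ultimately show ?thesis by simp
qed

lemma trajectory_piece_exists:
  assumes adm: "admissible Ob p \<sigma>" and p: "0 < p"
  shows "\<exists>\<gamma> L. trajectory_piece Ob \<gamma> L p \<sigma>"
proof -
  have vis: "visible Ob (\<sigma> n) (\<sigma> (Suc n))" if "n < p" for n
    using adm that unfolding admissible_def visible_def by metis
  have disj: "Q (\<sigma> n) \<inter> Q (\<sigma> (Suc n)) = {}" if "n < p" for n
    using vis[OF that] by (intro obstacle_disjoint) (simp add: visible_def)
  \<comment> \<open>\<open>obstacle_between\<close> also requires the middle obstacle to differ from
    both neighbours, so emptiness of the intersection needs these inequalities too.\<close>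
  have hull: "Q (\<sigma> (Suc n)) \<inter> convex hull (Q (\<sigma> n) \<union> Q (\<sigma> (Suc (Suc n)))) = {}" if "Suc n < p" for n
  proof -
    have "\<not> obstacle_between Ob (\<sigma> (Suc n)) (\<sigma> n) (\<sigma> (Suc (Suc n)))"
      using adm that unfolding admissible_def by blast
    moreover have "\<sigma> (Suc n) \<noteq> \<sigma> n" "\<sigma> (Suc n) \<noteq> \<sigma> (Suc (Suc n))"
      using vis[of n] vis[of "Suc n"] that by (auto simp: visible_def)
    ultimately show ?thesis by (simp add: obstacle_between_def)
  qed
  obtain x v where x: "\<And>n. x n \<in> Q (\<sigma> n)" and ne: "\<And>n. n < p \<Longrightarrow> x n \<noteq> x (Suc n)"
    and v: "\<And>n. v n = sgn (x (Suc n) - x n)"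
    and turn: "\<And>n. Suc n < p \<Longrightarrow> v n \<noteq> v (Suc n)"
      "\<And>n y. Suc n < p \<Longrightarrow> y \<in> Q (\<sigma> (Suc n)) \<Longrightarrow> (y - x (Suc n)) \<bullet> (v (Suc n) - v n) \<le> 0"
    and out: "\<And>n. n < p \<Longrightarrow> \<exists>u. (\<forall>y\<in>Q (\<sigma> n). (y - x n) \<bullet> u \<le> 0) \<and> (x (Suc n) - x n) \<bullet> u > 0"
    and inn: "\<And>n. n < p \<Longrightarrow>
      \<exists>u. (\<forall>y\<in>Q (\<sigma> (Suc n)). (y - x (Suc n)) \<bullet> u \<le> 0) \<and> (x (Suc n) - x n) \<bullet> u < 0"
    using billiard_path_exists[of "\<lambda>n. Q (\<sigma> n)" p, OF compact_obstacle convex_obstacle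
        obstacle_nonempty p disj hull] by blast
  define \<tau> where "\<tau> n = (\<Sum>k<n. dist (x k) (x (Suc k)))" for n
  have \<tau>: "\<tau> (Suc n) - \<tau> n = norm (x (Suc n) - x n)" for n
    by (simp add: \<tau>_def dist_norm norm_minus_commute)
  have mono: "\<tau> n < \<tau> (Suc n)" if "n < p" for n using ne[OF that] by (simp add: \<tau>_def)
  have step: "x (Suc n) = x n + (\<tau> (Suc n) - \<tau> n) *\<^sub>R v n" for n
    unfolding \<tau> v by (simp add: norm_scaleR_sgn)
  obtain \<gamma> where \<gamma>: "\<And>n. n \<le> p \<Longrightarrow> \<gamma> (\<tau> n) = x n"
    "\<And>n t. n < p \<Longrightarrow> t \<in> {\<tau> n..\<tau> (Suc n)} \<Longrightarrow> \<gamma> t = x n + (t - \<tau> n) *\<^sub>R v n"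
    using piecewise_linear_curve[of p \<tau> x v, OF mono step] by blast
  have nv: "norm (v n) = 1" if "n < p" for n using ne[OF that] by (simp add: v norm_sgn)
  have table: "\<gamma> t \<in> billiard_table Ob" if n: "n < p" and t: "t \<in> {\<tau> n..\<tau> (Suc n)}" for n t
  proof -
    have pos: "norm (x (Suc n) - x n) > 0" using ne[OF n] by simp
    define r where "r = (t - \<tau> n) / norm (x (Suc n) - x n)"
    have "0 \<le> r" "r \<le> 1" using t pos \<tau>[of n] by (auto simp: r_def)
    moreover have "\<gamma> t = (1 - r) *\<^sub>R x n + r *\<^sub>R x (Suc n)"
    proof -
      have "(t - \<tau> n) *\<^sub>R v n = r *\<^sub>R (x (Suc n) - x n)"
        by (simp add: v sgn_div_norm r_def divide_inverse)
      then have "\<gamma> t = x n + r *\<^sub>R (x (Suc n) - x n)" using \<gamma>(2)[OF n t] by simp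
      then show ?thesis by (simp add: algebra_simps)
    qed
    ultimately have "\<gamma> t \<in> closed_segment (x n) (x (Suc n))" by (auto simp: in_segment)
    moreover obtain u w where "\<forall>y\<in>Q (\<sigma> n). (y - x n) \<bullet> u \<le> 0" "(x (Suc n) - x n) \<bullet> u > 0"
      "\<forall>y\<in>Q (\<sigma> (Suc n)). (y - x (Suc n)) \<bullet> w \<le> 0" "(x (Suc n) - x n) \<bullet> w < 0"
      using out[OF n] inn[OF n] by blast
    then have "closed_segment (x n) (x (Suc n)) \<subseteq> billiard_table Ob"
      by (intro segment_billiard_table[OF vis[OF n] x x, where u = u and w = w]) auto
    ultimately show ?thesis by blast
  qed
  have front: "x n \<in> frontier (Q (\<sigma> n))" if n: "n \<le> p" for n
  proof -
    have "\<exists>u. u \<noteq> 0 \<and> (\<forall>y\<in>Q (\<sigma> n). (y - x n) \<bullet> u \<le> 0)"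
    proof (cases "n < p")
      case True
      then show ?thesis using out[OF True] by (metis inner_zero_right less_irrefl)
    next
      case False
      \<comment> \<open>The final point has no outgoing edge; its supporting direction comes from
        the incoming one, which exists since \<open>0 < p\<close>.\<close>
      then obtain m where "n = Suc m" "m < p" using p n by (cases n) auto
      then show ?thesis using inn[of m] by (metis inner_zero_right less_irrefl)
    qed
    then show ?thesis using supporting_point_frontier[OF x] by blast
  qed
  have "trajectory_piece Ob \<gamma> (\<tau> p) p \<sigma>"
    unfolding trajectory_piece_def
  proof (intro exI[of _ \<tau>] exI[of _ v] conjI allI impI ballI)
    show "\<tau> 0 = 0" by (simp add: \<tau>_def)
    show "\<gamma> (\<tau> n) \<in> frontier (Q (\<sigma> n))" if "n \<le> p" for n using front[OF that] \<gamma>(1)[OF that] by simp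
    show "\<gamma> t = \<gamma> (\<tau> n) + (t - \<tau> n) *\<^sub>R v n" if "n < p" "t \<in> {\<tau> n..\<tau> (Suc n)}" for n t
      using \<gamma>(2)[OF that] \<gamma>(1)[of n] that by simp
    show "reflects (Q (\<sigma> (Suc n))) (\<gamma> (\<tau> (Suc n))) (v n) (v (Suc n))" if "Suc n < p" for n
      using that \<gamma>(1)[of "Suc n"] by (simp add: reflects_of_difference x nv turn)
  qed (use mono nv table in auto)
  then show ?thesis by blast
qed

text \<open>The condition \<open>0 < L\<close> removes the pieces with \<open>p = 0\<close>, whose
  type has a single entry and thus no edge at which a connection could start.\<close>

definition trajectory_data :: "(real \<times> (real ^ 'm)) set" where
  "trajectory_data = {(L, \<gamma> L - \<gamma> 0) | L \<gamma>. 0 < L \<and>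
     (\<exists>p \<sigma>. admissible Ob p \<sigma> \<and> trajectory_piece Ob \<gamma> L p \<sigma>)}"

lemma trajectory_data_list:
  assumes "(L, d) \<in> trajectory_data"
  obtains qs where "admissible_list Ob qs" "2 \<le> length qs" "fst (hd qs) = 0"
    "min_length qs \<le> L" "L \<le> min_length qs + 2"
    "norm (d - int_vec (fst (last qs) - fst (hd qs))) \<le> CARD('m)"
proof -
  obtain \<gamma> p \<sigma> where *: "0 < L" "admissible Ob p \<sigma>" "trajectory_piece Ob \<gamma> L p \<sigma>" "d = \<gamma> L - \<gamma> 0"
    using assms unfolding trajectory_data_def by blast
  note tl = trajectory_piece_length[OF *(3)]
  have hd_last: "hd (map \<sigma> [0..<Suc p]) = \<sigma> 0" "last (map \<sigma> [0..<Suc p]) = \<sigma> p"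
    by (simp_all add: hd_map last_map del: upt_Suc)
  show thesis
  proof (rule that[of "map \<sigma> [0..<Suc p]"])
    show "admissible_list Ob (map \<sigma> [0..<Suc p])" "fst (hd (map \<sigma> [0..<Suc p])) = 0"
      using *(2) unfolding admissible_iff_list hd_last by blast+
    show "2 \<le> length (map \<sigma> [0..<Suc p])" using tl(3) *(1) by simp
    show "norm (d - int_vec (fst (last (map \<sigma> [0..<Suc p])) - fst (hd (map \<sigma> [0..<Suc p])))) \<le> CARD('m)"
      unfolding hd_last *(4) by (rule displacement_approx[OF tl(4,5)])
  qed (rule tl)+
qed

lemma list_trajectory_data:
  assumes "admissible_list Ob qs" "2 \<le> length qs" "fst (hd qs) = 0"
  obtains L d where "(L, d) \<in> trajectory_data" "min_length qs \<le> L" "L \<le> min_length qs + 2"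
    "norm (d - int_vec (fst (last qs) - fst (hd qs))) \<le> CARD('m)"
proof -
  define p where "p = length qs - 1"
  have p: "0 < p" "length qs = Suc p" using assms(2) by (auto simp: p_def)
  have qs: "map ((!) qs) [0..<Suc p] = qs" using map_nth[of qs] p(2) by simp
  have ends: "hd qs = qs ! 0" "last qs = qs ! p"
    using p by (auto simp: hd_conv_nth last_conv_nth simp flip: length_greater_0_conv)
  have adm: "admissible Ob p ((!) qs)"
    unfolding admissible_iff_list qs using assms ends by simp
  obtain \<gamma> L where tr: "trajectory_piece Ob \<gamma> L p ((!) qs)"
    using trajectory_piece_exists[OF adm p(1)] by blast
  note tl = trajectory_piece_length[OF tr, unfolded qs]
  show thesis
  proof (rule that)
    show "(L, \<gamma> L - \<gamma> 0) \<in> trajectory_data"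
      unfolding trajectory_data_def using adm tr tl(3) p(1) by blast
    show "norm (\<gamma> L - \<gamma> 0 - int_vec (fst (last qs) - fst (hd qs))) \<le> CARD('m)"
      unfolding ends by (rule displacement_approx[OF tl(4,5)])
  qed (rule tl)+
qed

text \<open>The length error is at most \<open>7 * (CARD('m) + 1) + 2\<close> above and 4 below; the
  displacement error is at most \<open>3 * CARD('m) + 7\<close>. The stated constant covers all of
  these.\<close>

lemma trajectory_data_almost_additive:
  assumes x: "x \<in> trajectory_data" and y: "y \<in> trajectory_data"
  shows "\<exists>z\<in>trajectory_data. \<bar>fst z - fst x - fst y\<bar> \<le> 7 * CARD('m) + 11 \<and>
           norm (snd z - snd x - snd y) \<le> 7 * CARD('m) + 11"
proof -
  obtain L d L' d' where xy: "x = (L, d)" "y = (L', d')" by (cases x, cases y)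
  obtain A where A: "admissible_list Ob A" "2 \<le> length A" "fst (hd A) = 0"
    "min_length A \<le> L" "L \<le> min_length A + 2"
    "norm (d - int_vec (fst (last A) - fst (hd A))) \<le> CARD('m)"
    using trajectory_data_list x xy(1) by blast
  obtain C where C: "admissible_list Ob C" "2 \<le> length C" "fst (hd C) = 0"
    "min_length C \<le> L'" "L' \<le> min_length C + 2"
    "norm (d' - int_vec (fst (last C) - fst (hd C))) \<le> CARD('m)"
    using trajectory_data_list y xy(2) by blast
  obtain ws k where ws: "length ws \<le> 6" "admissible_list Ob (A @ ws @ map (shift k) C)"
    "successively nearby (last A # ws @ [shift k (hd C)])"
    using connect_lists[OF A(1,2) C(1,2)] by blast
  define qs where "qs = A @ ws @ map (shift k) C"
  have ne: "A \<noteq> []" "C \<noteq> []" using A(2) C(2) by auto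
  have ends: "hd qs = hd A" "last qs = shift k (last C)" using ne by (simp_all add: qs_def last_map)
  obtain M e where M: "(M, e) \<in> trajectory_data" "min_length qs \<le> M" "M \<le> min_length qs + 2"
    "norm (e - int_vec (fst (last qs) - fst (hd qs))) \<le> CARD('m)"
    by (rule list_trajectory_data[of qs]) (use ws(2) A ends in \<open>auto simp: qs_def\<close>)
  have "min_length A + min_length C \<le> min_length qs"
    using min_length_append[of A "ws @ map (shift k) C"] min_length_append[of ws "map (shift k) C"]
      min_length_nonneg[of ws] by (simp add: qs_def)
  moreover have "min_length qs \<le> min_length A + min_length C + 7 * (CARD('m) + 1)"
  proof -
    have "(length ws + 1) * (CARD('m) + 1) \<le> 7 * (CARD('m) + 1)"
      using ws(1) by (intro mult_right_mono) auto
    then have "real ((length ws + 1) * (CARD('m) + 1)) \<le> real (7 * (CARD('m) + 1))"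
      unfolding of_nat_le_iff .
    then show ?thesis
      using min_length_connect[of A "map (shift k) C" ws] ne ws(3) by (simp add: qs_def hd_map)
  qed
  ultimately have "\<bar>M - L - L'\<bar> \<le> 7 * CARD('m) + 11"
    using A(4,5) C(4,5) M(2,3) by simp
  moreover have "norm (e - d - d') \<le> 7 * CARD('m) + 11"
  proof -
    \<comment> \<open>Cell displacements telescope exactly along the joined list, so apart from the
      three in-cell errors only the displacement \<open>g\<close> across the connection
      remains.\<close>
    define g where "g = int_vec (fst (shift k (hd C)) - fst (last A))"
    have g: "norm g \<le> 7" using nearby_displacement[OF ws(3)] ws(1) by (simp add: g_def)
    define X where "X = e - int_vec (fst (last qs) - fst (hd qs))"
    define Y where "Y = d - int_vec (fst (last A) - fst (hd A))"
    define Z where "Z = d' - int_vec (fst (last C) - fst (hd C))"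
    have "e - d - d' = X - Y - Z + g" by (simp add: X_def Y_def Z_def ends g_def)
    moreover have "norm X \<le> CARD('m)" "norm Y \<le> CARD('m)" "norm Z \<le> CARD('m)"
      unfolding X_def Y_def Z_def by (rule M(4) A(6) C(6))+
    ultimately show ?thesis
      using norm_triangle_ineq[of "X - Y - Z" g] norm_triangle_ineq4[of "X - Y" Z]
        norm_triangle_ineq4[of X Y] g by simp
  qed
  ultimately show ?thesis using M(1) xy by (intro bexI[of _ "(M, e)"]) auto
qed

text \<open>A subsequence of pieces is itself a sequence of pieces whose lengths tend to infinity,
  so limit points can be replaced by limits.\<close>

lemma admissible_rotation_set_eq: "admissible_rotation_set Ob = asymptotic_ratios trajectory_data"
proof (intro equalityI subsetI)
  fix w assume "w \<in> admissible_rotation_set Ob"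
  then obtain \<gamma> L p \<sigma> s where *: "\<And>n. admissible Ob (p n) (\<sigma> n)"
    "\<And>n. trajectory_piece Ob (\<gamma> n) (L n) (p n) (\<sigma> n)" "filterlim L at_top sequentially"
    "strict_mono s" "((\<lambda>n. (\<gamma> n (L n) - \<gamma> n 0) /\<^sub>R L n) \<circ> s) \<longlonglongrightarrow> w"
    unfolding admissible_rotation_set_def by blast
  have Ls: "filterlim (\<lambda>n. L (s n)) at_top sequentially"
    using filterlim_compose[OF *(3) filterlim_subseq[OF *(4)]] .
  then have "eventually (\<lambda>n. 0 < L (s n)) sequentially" by (simp add: filterlim_at_top_dense)
  then obtain n0 where n0: "\<And>n. n \<ge> n0 \<Longrightarrow> 0 < L (s n)" by (auto simp: eventually_sequentially)
  \<comment> \<open>The finitely many terms before \<open>n0\<close> are dropped, because every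
    entry must have positive length to belong to \<open>trajectory_data\<close>.\<close>
  define e where "e n = (L (s (n + n0)), \<gamma> (s (n + n0)) (L (s (n + n0))) - \<gamma> (s (n + n0)) 0)" for n
  have "e n \<in> trajectory_data" for n
    unfolding e_def trajectory_data_def using *(1,2) n0[of "n + n0"]
    by (intro CollectI exI[of _ "L (s (n + n0))"] exI[of _ "\<gamma> (s (n + n0))"]) auto
  moreover have "filterlim (\<lambda>n. fst (e n)) at_top sequentially"
    using filterlim_compose[OF Ls filterlim_add_const_nat_at_top[of n0]] by (simp add: e_def)
  moreover have "(\<lambda>n. snd (e n) /\<^sub>R fst (e n)) \<longlonglongrightarrow> w"
    using LIMSEQ_ignore_initial_segment[OF *(5), of n0] by (simp add: e_def)
  ultimately show "w \<in> asymptotic_ratios trajectory_data" unfolding asymptotic_ratios_def by blast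
next
  fix w assume "w \<in> asymptotic_ratios trajectory_data"
  then obtain e where e: "\<And>n. e n \<in> trajectory_data" "filterlim (\<lambda>n. fst (e n)) at_top sequentially"
    "(\<lambda>n. snd (e n) /\<^sub>R fst (e n)) \<longlonglongrightarrow> w"
    unfolding asymptotic_ratios_def by blast
  have "\<forall>n. \<exists>\<gamma> p \<sigma>. admissible Ob p \<sigma> \<and> trajectory_piece Ob \<gamma> (fst (e n)) p \<sigma> \<and>
      snd (e n) = \<gamma> (fst (e n)) - \<gamma> 0"
  proof
    fix n
    obtain \<gamma> L p \<sigma> where "e n = (L, \<gamma> L - \<gamma> 0)" "admissible Ob p \<sigma>" "trajectory_piece Ob \<gamma> L p \<sigma>"
      using e(1)[of n] unfolding trajectory_data_def by blast
    then show "\<exists>\<gamma> p \<sigma>. admissible Ob p \<sigma> \<and> trajectory_piece Ob \<gamma> (fst (e n)) p \<sigma> \<and>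
        snd (e n) = \<gamma> (fst (e n)) - \<gamma> 0"
      by (intro exI[of _ \<gamma>] exI[of _ p] exI[of _ \<sigma>]) simp
  qed
  then obtain \<gamma> p \<sigma> where *: "\<And>n. admissible Ob (p n) (\<sigma> n)"
    "\<And>n. trajectory_piece Ob (\<gamma> n) (fst (e n)) (p n) (\<sigma> n)"
    "\<And>n. snd (e n) = \<gamma> n (fst (e n)) - \<gamma> n 0"
    by metis
  have "((\<lambda>n. (\<gamma> n (fst (e n)) - \<gamma> n 0) /\<^sub>R fst (e n)) \<circ> id) \<longlonglongrightarrow> w"
    using e(3) by (simp add: *(3))
  then show "w \<in> admissible_rotation_set Ob"
    unfolding admissible_rotation_set_def using *(1,2) e(2) strict_mono_id
    by (intro CollectI exI[of _ \<gamma>] exI[of _ "\<lambda>n. fst (e n)"] exI[of _ p] exI[of _ \<sigma>] exI[of _ id]) auto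
qed

lemma convex_admissible_rotation_set: "convex (admissible_rotation_set Ob)"
  unfolding admissible_rotation_set_eq
  by (rule convex_asymptotic_ratios[OF trajectory_data_almost_additive])
     (auto simp: trajectory_data_def)

end

theorem theorem4p1:
  fixes Ob :: "'n::finite \<Rightarrow> ('m::finite) torus set"
  assumes "CARD('m) \<ge> 2"
    and "standing_assumptions Ob"
  shows "convex (admissible_rotation_set Ob)"
proof -
  interpret obstacle_family Ob using assms by unfold_locales
  show ?thesis by (rule convex_admissible_rotation_set)
qed

end
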